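(* Let $m\ge1$, $n\ge1$, $c\ge1$ be integers with $c>2n-2$. Let $F$ be the free group on the totally ordered set $X=\{x_1<\dots<x_m\}$ and $G=F/\gamma_{n+1}(F)$, the free nilpotent group of class $n$ and rank $m$ (the $n$-th nilpotent product of $m$ copies of $\mathbb{Z}$). Let $Y$ be the set of all basic commutators on $X$ of weights $c+1,\dots,c+n$ and $Z=\{[b,a]: a,b\in Y,\ b>a\}$. Then $$\mathcal{N}_{c,1}M(G)=\frac{\gamma_2(\gamma_{c+1}(F))}{[\gamma_{c+n+1}(F),\gamma_{c+1}(F)]}$$ is a free abelian group with basis $\{z\,[\gamma_{c+n+1}(F),\gamma_{c+1}(F)] : z\in Z\}$ (distinct elements of $Z$ giving distinct basis elements).
   Context: $\gamma_k(F)$ is the $k$-th term of the lower central series, $\gamma_2(H)=[H,H]$. For a group $G$ with free presentation $G\cong F/R$, the polynilpotent multiplier of class row $(c,1)$ (Baer invariant with respect to the variety $\mathcal{N}_{c,1}$ of groups having a normal subgroup $N$ nilpotent... equivalently with verbal subgroup $\gamma_2(\gamma_{c+1}(F))$) is $\mathcal{N}_{c,1}M(G)=\dfrac{R\cap\gamma_2(\gamma_{c+1}(F))}{[R,{}_cF,\gamma_{c+1}(F)]}$, where $[R,{}_1F]=[R,F]$, $[R,{}_cF]=[[R,{}_{c-1}F],F]$ and $[R,{}_cF,\gamma_{c+1}(F)]=[[R,{}_cF],\gamma_{c+1}(F)]$; for $R=\gamma_{n+1}(F)$ this equals the displayed quotient. Basic commutators on a totally ordered set $X$ of free generators are defined inductively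 with their weights $wt$: the elements of $X$ are the basic commutators of weight 1, ordered as in $X$. Assuming basic commutators of weight $<k$ have been defined and ordered, a commutator $[b,a]$ is a basic commutator of weight $k$ if $b,a$ are basic commutators with $wt(a)+wt(b)=k$, $b>a$, and, if $b=[b_1,b_2]$, then $b_2\le a$. The ordering is then extended to weight $k$ so that all basic commutators of smaller weight precede those of weight $k$; $Y$ carries the inherited order. *)

theory Defs
  imports "HOL-Algebra.Free_Abelian_Groups" "HOL-Algebra.Generated_Groups" "HOL-Algebra.Coset"
begin

text \<open>A letter (i, False) stands for x_i, (i, True) for its inverse.\<close>
type_synonym letter = "nat \<times> bool"

fun letter_inv :: "letter \<Rightarrow> letter" where
  "letter_inv (i, b) = (i, \<not> b)"

fun reduced :: "letter list \<Rightarrow> bool" where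
  "reduced [] = True"
| "reduced [x] = True"
| "reduced (x # y # ws) = (y \<noteq> letter_inv x \<and> reduced (y # ws))"

fun red_cons :: "letter \<Rightarrow> letter list \<Rightarrow> letter list" where
  "red_cons l [] = [l]"
| "red_cons l (w # ws) = (if w = letter_inv l then ws else l # w # ws)"

definition reduce :: "letter list \<Rightarrow> letter list" where
  "reduce xs = foldr red_cons xs []"

definition free_group_on :: "nat \<Rightarrow> letter list monoid" where
  "free_group_on m = \<lparr> carrier = {w. reduced w \<and> (\<forall>l\<in>set w. fst l \<in> {1..m})},
                       monoid.mult = (\<lambda>x y. reduce (x @ y)),
                       one = [] \<rparr>"

definition gcomm :: "('a, 'b) monoid_scheme \<Rightarrow> 'a \<Rightarrow> 'a \<Rightarrow> 'a" where
  "gcomm G x y = inv\<^bsub>G\<^esub> x \<otimes>\<^bsub>G\<^esub> inv\<^bsub>G\<^esub> y \<otimes>\<^bsub>G\<^esub> x \<otimes>\<^bsub>G\<^esub> y"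

definition comm_sub :: "('a, 'b) monoid_scheme \<Rightarrow> 'a set \<Rightarrow> 'a set \<Rightarrow> 'a set" where
  "comm_sub G H K = generate G {gcomm G h k | h k. h \<in> H \<and> k \<in> K}"

fun gamma :: "('a, 'b) monoid_scheme \<Rightarrow> nat \<Rightarrow> 'a set" where
  "gamma G 0 = carrier G"
| "gamma G (Suc 0) = carrier G"
| "gamma G (Suc (Suc k)) = comm_sub G (gamma G (Suc k)) (carrier G)"

fun iter_comm :: "('a, 'b) monoid_scheme \<Rightarrow> 'a set \<Rightarrow> nat \<Rightarrow> 'a set" where
  "iter_comm G R 0 = R"
| "iter_comm G R (Suc c) = comm_sub G (iter_comm G R c) (carrier G)"

definition nc1_multiplier :: "('a, 'b) monoid_scheme \<Rightarrow> 'a set \<Rightarrow> nat \<Rightarrow> 'a set monoid" where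
  "nc1_multiplier F R c =
     (F\<lparr>carrier := R \<inter> comm_sub F (gamma F (c+1)) (gamma F (c+1))\<rparr>)
       Mod (comm_sub F (iter_comm F R c) (gamma F (c+1)))"

datatype cterm = Gen nat | Comm cterm cterm

fun wt :: "cterm \<Rightarrow> nat" where
  "wt (Gen i) = 1"
| "wt (Comm b a) = wt b + wt a"

definition admissible_order :: "(cterm \<times> cterm) set \<Rightarrow> bool" where
  "admissible_order r \<longleftrightarrow> strict_linear_order_on UNIV r
     \<and> (\<forall>a b. wt a < wt b \<longrightarrow> (a, b) \<in> r)
     \<and> (\<forall>i j. (Gen i, Gen j) \<in> r \<longleftrightarrow> i < j)"

inductive basic :: "nat \<Rightarrow> (cterm \<times> cterm) set \<Rightarrow> cterm \<Rightarrow> bool" for m r where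
  gen: "1 \<le> i \<Longrightarrow> i \<le> m \<Longrightarrow> basic m r (Gen i)"
| comm: "basic m r b \<Longrightarrow> basic m r a \<Longrightarrow> (a, b) \<in> r \<Longrightarrow>
         (\<forall>b1 b2. b = Comm b1 b2 \<longrightarrow> (b2 = a \<or> (b2, a) \<in> r)) \<Longrightarrow> basic m r (Comm b a)"

fun ceval :: "nat \<Rightarrow> cterm \<Rightarrow> letter list" where
  "ceval m (Gen i) = [(i, False)]"
| "ceval m (Comm b a) = gcomm (free_group_on m) (ceval m b) (ceval m a)"

definition free_abelian_basis :: "('a, 'b) monoid_scheme \<Rightarrow> 'a set \<Rightarrow> bool" where
  "free_abelian_basis G B \<longleftrightarrow> comm_group G \<and> B \<subseteq> carrier G \<and>
     (\<exists>h. h \<in> iso (free_Abelian_group B) G \<and> (\<forall>b\<in>B. h (frag_of b) = b))"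

end

theory Submission
  imports Defs
begin

text \<open>
  Write \<open>s = c + 1\<close> and \<open>d = 2s + 2n - 1\<close>. Modulo \<open>N\<close> the commutator is bilinear on \<open>\<gamma>\<^sub>s\<close> and kills
  \<open>\<gamma>\<^bsub>s+n\<^esub>\<close>, so \<open>Z\<close> generates the quotient because basic commutators generate \<open>\<gamma>\<^sub>k\<close> modulo \<open>\<gamma>\<^bsub>k+1\<^esub>\<close>.

  For independence, let \<open>\<mu>\<close> be the Magnus embedding. As \<open>d \<le> 3s\<close>, the map \<open>g \<mapsto> \<mu> g - 1\<close> modulo degree \<open>d\<close>
  is additive on \<open>\<gamma>\<^sub>2(\<gamma>\<^sub>s)\<close> and sends \<open>[h, k]\<close> to the Lie bracket of \<open>\<mu> h - 1\<close> and \<open>\<mu> k - 1\<close>. Hence it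
  maps \<open>N\<close> into the span of the images of commutators \<open>[u, v]\<close> with \<open>u\<close> of weight at least \<open>s + n\<close>. These
  and the elements of \<open>Z\<close> are pairwise distinct basic commutators of weight below \<open>d\<close>, and the image of
  a basic commutator has its Lie polynomial as leading term. Lie polynomials of basic commutators
  of equal weight are linearly independent by Lazard elimination: the basic commutators of smaller
  weight are eliminated in increasing order, after which the remaining ones are free variables.
\<close>

section \<open>Basic commutators and the free associative ring\<close>

lemma frag_extend_comp:
  "frag_extend g (frag_extend f x) = frag_extend (\<lambda>a. frag_extend g (f a)) x"
  by (rule frag_induction[OF subset_UNIV]) (auto simp: frag_extend_diff)

section \<open>Admissible orders and finiteness of basic commutators by weight\<close>

lemma wt_pos: "0 < wt a"
  by (induction a) auto

lemma admissible_irrefl: "admissible_order r \<Longrightarrow> (a, a) \<notin> r"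
  by (auto simp: admissible_order_def strict_linear_order_on_def irrefl_def)

lemma admissible_trans: "admissible_order r \<Longrightarrow> (a, b) \<in> r \<Longrightarrow> (b, c) \<in> r \<Longrightarrow> (a, c) \<in> r"
  by (auto simp: admissible_order_def strict_linear_order_on_def dest: transD)

lemma admissible_total: "admissible_order r \<Longrightarrow> a \<noteq> b \<Longrightarrow> (a, b) \<in> r \<or> (b, a) \<in> r"
  by (auto simp: admissible_order_def strict_linear_order_on_def total_on_def)

lemma admissible_asym: "admissible_order r \<Longrightarrow> (a, b) \<in> r \<Longrightarrow> (b, a) \<notin> r"
  using admissible_irrefl admissible_trans by blast

lemma admissible_wt: "admissible_order r \<Longrightarrow> wt a < wt b \<Longrightarrow> (a, b) \<in> r"
  by (auto simp: admissible_order_def)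

lemma admissible_wt_le: "admissible_order r \<Longrightarrow> (a, b) \<in> r \<Longrightarrow> wt a \<le> wt b"
  by (meson admissible_asym admissible_wt not_le)

inductive_cases basic_CommE: "basic m r (Comm b a)"
inductive_cases basic_GenE: "basic m r (Gen i)"

text \<open>Used for two purposes: the elimination runs through this set, and its finiteness makes
  the descending induction on the smaller entry of a bracket well founded.\<close>

lemma finite_basic_wt_less: "finite {b. basic m r b \<and> wt b < k}"
proof (induction k)
  case (Suc k)
  let ?B = "{b. basic m r b \<and> wt b < k}"
  have "{b. basic m r b \<and> wt b < Suc k} \<subseteq> Gen ` {1..m} \<union> (\<lambda>(b, a). Comm b a) ` (?B \<times> ?B)"
  proof
    fix b assume b: "b \<in> {b. basic m r b \<and> wt b < Suc k}"
    show "b \<in> Gen ` {1..m} \<union> (\<lambda>(b, a). Comm b a) ` (?B \<times> ?B)"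
    proof (cases b)
      case (Gen i)
      with b show ?thesis by (auto elim: basic_GenE)
    next
      case (Comm e a)
      have "basic m r e" "basic m r a" using b Comm by (auto elim: basic_CommE)
      moreover have "wt e < k" "wt a < k"
        using b Comm wt_pos[of e] wt_pos[of a] by auto
      ultimately show ?thesis using Comm by auto
    qed
  qed
  moreover have "finite (Gen ` {1..m} \<union> (\<lambda>(b, a). Comm b a) ` (?B \<times> ?B))"
    using Suc by auto
  ultimately show ?case by (rule finite_subset)
qed auto

lemma admissible_ex_min:
  assumes r: "admissible_order r" and fin: "finite B" and ne: "B \<noteq> {}"
  obtains c where "c \<in> B" "\<And>a. a \<in> B \<Longrightarrow> a = c \<or> (c, a) \<in> r"
proof -
  have "\<exists>c\<in>B. \<forall>a\<in>B. a = c \<or> (c, a) \<in> r"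
    using fin ne
  proof (induction rule: finite_ne_induct)
    case (insert x B)
    then obtain c where c: "c \<in> B" "\<forall>a\<in>B. a = c \<or> (c, a) \<in> r" by blast
    show ?case
    proof (cases "(x, c) \<in> r")
      case True
      then have "(x, a) \<in> r" if "a \<in> B" for a
        using c(2) that admissible_trans[OF r True, of a] by auto
      then show ?thesis by auto
    next
      case False
      then have "x = c \<or> (c, x) \<in> r" using admissible_total[OF r, of x c] by auto
      then show ?thesis using c by auto
    qed
  qed auto
  then show thesis using that by blast
qed

text \<open>Words are wrapped so that concatenation can be the additive monoid structure that
  \<^typ>\<open>'a \<Rightarrow>\<^sub>0 int\<close> expects of its exponents; \<open>pol\<close> is then the free associative ring whose variables
  are \<^emph>\<open>all\<close> commutator terms.\<close>

datatype fword = W (letters: "cterm list")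

instantiation fword :: monoid_add
begin
definition zero_fword where "zero_fword = W []"
definition plus_fword where "plus_fword u v = W (letters u @ letters v)"
instance by standard (auto simp: zero_fword_def plus_fword_def)
end

type_synonym pol = "fword \<Rightarrow>\<^sub>0 int"

definition mon :: "cterm list \<Rightarrow> pol" where
  "mon w = frag_of (W w)"

abbreviation var :: "cterm \<Rightarrow> pol" where
  "var x \<equiv> mon [x]"

lemma mon_append: "mon (u @ v) = mon u * mon v"
  by (simp add: mon_def mult_single plus_fword_def)

lemma mon_Nil: "mon [] = 1"
  by (simp add: mon_def flip: single_one zero_fword_def)

lemma mon_Cons: "mon (x # v) = var x * mon v"
  using mon_append[of "[x]" v] by simp

lemma pol_induct [case_names zero mon diff]:
  assumes "P 0" "\<And>w. P (mon w)" "\<And>p q. P p \<Longrightarrow> P q \<Longrightarrow> P (p - q)"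
  shows "P (p :: pol)"
proof (rule frag_induction[of p UNIV])
  fix x show "P (frag_of x)" using assms(2)[of "letters x"] by (simp add: mon_def)
qed (use assms in auto)

section \<open>Lie polynomials and Lazard elimination\<close>

definition bracket :: "pol \<Rightarrow> pol \<Rightarrow> pol" where
  "bracket p q = p * q - q * p"

text \<open>Partial expansion of a commutator term as a Lie polynomial: a bracket with right entry in
  \<open>E\<close> is treated as a new variable, so \<open>E = {}\<close> gives the full expansion.\<close>

fun lie_pol :: "cterm set \<Rightarrow> cterm \<Rightarrow> pol" where
  "lie_pol E (Gen i) = var (Gen i)"
| "lie_pol E (Comm b a) =
     (if a \<in> E then var (Comm b a) else bracket (lie_pol E b) (lie_pol E a))"

fun deriv_word :: "cterm \<Rightarrow> cterm list \<Rightarrow> pol" where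
  "deriv_word c [] = 0"
| "deriv_word c (x # w) = var (Comm x c) * mon w + var x * deriv_word c w"

definition lderiv :: "cterm \<Rightarrow> pol \<Rightarrow> pol" where
  "lderiv c = frag_extend (\<lambda>w. deriv_word c (letters w))"

lemma lderiv_mon: "lderiv c (mon w) = deriv_word c w"
  by (simp add: lderiv_def mon_def)

lemma lderiv_diff: "lderiv c (p - q) = lderiv c p - lderiv c q"
  by (simp add: lderiv_def frag_extend_diff)

lemma lderiv_zero: "lderiv c 0 = 0"
  by (simp add: lderiv_def)

lemma lderiv_var: "lderiv c (var x) = var (Comm x c)"
  by (simp add: lderiv_mon mon_Nil)

lemma deriv_word_append:
  "deriv_word c (u @ v) = deriv_word c u * mon v + mon u * deriv_word c v"
proof (induction u)
  case (Cons x u)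
  have "mon (x # u) = var x * mon u" by (rule mon_Cons)
  with Cons show ?case by (simp add: mon_append algebra_simps)
qed (simp add: mon_Nil)

lemma lderiv_mult: "lderiv c (p * q) = lderiv c p * q + p * lderiv c q"
proof (induction p rule: pol_induct)
  case (mon u)
  show ?case
  proof (induction q rule: pol_induct)
    case (mon v)
    show ?case by (simp add: lderiv_mon deriv_word_append flip: mon_append)
  qed (auto simp: lderiv_zero lderiv_diff algebra_simps)
qed (auto simp: lderiv_zero lderiv_diff algebra_simps)

text \<open>The right action of the ring on itself in which the variable \<open>c\<close> acts as the derivation
  \<open>x \<mapsto> [x, c]\<close> and every other variable by multiplication. An iterated bracket \<open>[b, c, \<dots>, c]\<close> then acts
  as multiplication by the corresponding new variable, which is Lazard elimination of \<open>c\<close>.\<close>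

fun act_word :: "cterm \<Rightarrow> pol \<Rightarrow> cterm list \<Rightarrow> pol" where
  "act_word c u [] = u"
| "act_word c u (x # w) = act_word c (if x = c then lderiv c u else u * var x) w"

definition act :: "cterm \<Rightarrow> pol \<Rightarrow> pol \<Rightarrow> pol" where
  "act c u = frag_extend (\<lambda>w. act_word c u (letters w))"

lemma act_mon: "act c u (mon w) = act_word c u w"
  by (simp add: act_def mon_def)

lemma act_diff: "act c u (p - q) = act c u p - act c u q"
  by (simp add: act_def frag_extend_diff)

lemma act_zero: "act c u 0 = 0"
  by (simp add: act_def)

lemma act_word_append: "act_word c u (v @ w) = act_word c (act_word c u v) w"
  by (induction v arbitrary: u) auto

lemma act_word_zero: "act_word c 0 w = 0"
  by (induction w) (auto simp: lderiv_zero)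

lemma act_word_diff: "act_word c (u - v) w = act_word c u w - act_word c v w"
  by (induction w arbitrary: u v) (auto simp: lderiv_diff algebra_simps)

lemma act_zero_left: "act c 0 p = 0"
  by (induction p rule: pol_induct) (auto simp: act_mon act_word_zero act_zero act_diff)

lemma act_diff_left: "act c (u - v) p = act c u p - act c v p"
  by (induction p rule: pol_induct) (auto simp: act_mon act_word_diff act_zero act_diff)

lemma act_mult: "act c u (p * q) = act c (act c u p) q"
proof (induction p rule: pol_induct)
  case (mon v)
  show ?case
  proof (induction q rule: pol_induct)
    case (mon w)
    show ?case by (simp add: act_mon act_word_append flip: mon_append)
  qed (auto simp: act_zero act_diff algebra_simps)
qed (auto simp: act_zero act_diff act_zero_left act_diff_left algebra_simps)

text \<open>Induction along the basic commutator. Bracketing two right multiplications gives right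
  multiplication by the bracket; bracketing right multiplication by \<open>p\<close> with the
  derivation gives right multiplication by \<open>lderiv c p\<close>, so \<open>[e, c]\<close> acts
  as the variable \<open>Comm e c\<close>. That \<open>b\<close> exceeds \<open>c\<close> excludes
  the one variable that does not act by multiplication.\<close>

lemma act_lie_pol:
  assumes r: "admissible_order r" and c: "basic m r c" "c \<notin> E"
    and E: "\<And>a. basic m r a \<Longrightarrow> a \<in> E \<longleftrightarrow> (a, c) \<in> r"
    and b: "basic m r b" "(c, b) \<in> r"
  shows "act c u (lie_pol E b) = u * lie_pol (insert c E) b"
  using b
proof (induction b arbitrary: u)
  case (gen i)
  have "Gen i \<noteq> c" using gen admissible_irrefl[OF r] by auto
  then show ?case by (simp add: act_mon)
next
  case (comm e a)
  note basics = comm(1,2) and ae = comm(3) and cond = comm(4)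
  note IH_e = comm.IH(1) and IH_a = comm.IH(2)
  show ?case
  proof (cases "a \<in> E")
    case True
    have "Comm e a \<noteq> c" using comm.prems admissible_irrefl[OF r] by auto
    with True show ?thesis by (simp add: act_mon)
  next
    case a: False
    show ?thesis
    proof (cases "a = c")
      case True
      \<comment> \<open>The defining condition on the basic commutator \<open>[e, c]\<close> says
        that a right entry of \<open>e\<close> is at most \<open>c\<close>, hence lies in
        \<open>insert c E\<close>; so \<open>e\<close> is a single variable.\<close>
      have e: "lie_pol (insert c E) e = var e"
      proof (cases e)
        case (Comm e1 e2)
        then have "basic m r e2" "e2 = c \<or> (e2, c) \<in> r"
          using basics cond True by (auto elim: basic_CommE)
        then show ?thesis using Comm E by auto
      qed auto
      \<comment> \<open>A right entry of \<open>c\<close> has smaller weight than \<open>c\<close>,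
        so it is already in \<open>E\<close>.\<close>
      have cvar: "lie_pol E c = var c"
      proof (cases c)
        case (Comm c1 c2)
        then have "basic m r c2" using c by (auto elim: basic_CommE)
        moreover have "(c2, c) \<in> r"
          using Comm wt_pos[of c1] by (intro admissible_wt[OF r]) auto
        ultimately show ?thesis using Comm E by auto
      qed auto
      have "act c u (lie_pol E (Comm e a)) =
          lderiv c (u * var e) - lderiv c u * var e"
        using a True IH_e[of "u"] IH_e[of "lderiv c u"] ae
        by (simp add: bracket_def act_diff act_mult cvar act_mon e)
      also have "\<dots> = u * var (Comm e a)"
        by (simp add: lderiv_mult lderiv_var True)
      finally show ?thesis using True by simp
    next
      case False
      \<comment> \<open>Here \<open>c < a < e\<close>, so both entries act by multiplication and the
        bracket survives unchanged.\<close>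
      have ca: "(c, a) \<in> r" using False a E[OF basics(2)] admissible_total[OF r] by blast
      then have ce: "(c, e) \<in> r" using ae admissible_trans[OF r] by blast
      have "act c u (lie_pol E (Comm e a)) = u * bracket (lie_pol (insert c E) e) (lie_pol (insert c E) a)"
        using a IH_e[OF ce] IH_a[OF ca]
        by (simp add: bracket_def act_diff act_mult algebra_simps)
      then show ?thesis using False a by simp
    qed
  qed
qed

text \<open>Applying the linear map \<open>act c 1\<close> to the relation replaces \<open>E\<close>
  by \<open>insert c E\<close> and leaves the coefficients alone. After all basic commutators of
  weight below \<open>w\<close> are eliminated, a relation between distinct variables
  remains.\<close>

lemma lie_pol_independent:
  assumes r: "admissible_order r"
    and x: "Poly_Mapping.keys x \<subseteq> {b. basic m r b \<and> wt b = w}"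
    and rel: "frag_extend (lie_pol {}) x = 0"
  shows "x = 0"
proof -
  let ?B = "{b. basic m r b \<and> wt b < w}"
  \<comment> \<open>After \<open>k\<close> eliminations \<open>E\<close> is an initial segment of
    the basic commutators of weight below \<open>w\<close>. This makes the least remaining element
    \<open>c\<close> satisfy the hypothesis on \<open>E\<close> in
    \<open>act_lie_pol\<close>.\<close>
  have "\<exists>E\<subseteq>?B. card E = k \<and> (\<forall>e\<in>E. \<forall>a. basic m r a \<longrightarrow> (a, e) \<in> r \<longrightarrow> a \<in> E) \<and>
      frag_extend (lie_pol E) x = 0" if "k \<le> card ?B" for k
    using that
  proof (induction k)
    case 0
    then show ?case using rel by (intro exI[of _ "{}"]) auto
  next
    case (Suc k)
    then obtain E where E: "E \<subseteq> ?B" "card E = k"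
        "\<And>e a. e \<in> E \<Longrightarrow> basic m r a \<Longrightarrow> (a, e) \<in> r \<Longrightarrow> a \<in> E"
        "frag_extend (lie_pol E) x = 0"
      by (metis (no_types, lifting) Suc_leD)
    have finE: "finite E" using E(1) finite_basic_wt_less finite_subset by blast
    have "?B - E \<noteq> {}" using Suc.prems E(1,2) by (metis (no_types, lifting) Diff_eq_empty_iff card_mono finE not_less_eq_eq order_refl)
    then obtain c where c: "c \<in> ?B - E" "\<And>a. a \<in> ?B - E \<Longrightarrow> a = c \<or> (c, a) \<in> r"
      using admissible_ex_min[OF r, of "?B - E"] finite_basic_wt_less[of m r w] by blast
    have Ec: "a \<in> E \<longleftrightarrow> (a, c) \<in> r" if "basic m r a" for a
    proof
      assume "a \<in> E"
      then have "a \<noteq> c" "(c, a) \<notin> r" using c(1) E(3) by auto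
      then show "(a, c) \<in> r" using admissible_total[OF r] by blast
    next
      assume ac: "(a, c) \<in> r"
      show "a \<in> E"
      proof (rule ccontr)
        assume "a \<notin> E"
        then have "a \<in> ?B - E" using that admissible_wt_le[OF r ac] c(1) by auto
        then show False using c(2) ac admissible_asym[OF r ac] admissible_irrefl[OF r] by blast
      qed
    qed
    have act: "act c 1 (lie_pol E b) = lie_pol (insert c E) b" if "b \<in> Poly_Mapping.keys x" for b
    proof -
      have "basic m r b" "(c, b) \<in> r"
        using that x c(1) by (auto intro!: admissible_wt[OF r])
      then show ?thesis using act_lie_pol[OF r _ _ Ec, where u = 1] c(1) by auto
    qed
    have "frag_extend (lie_pol (insert c E)) x = frag_extend (\<lambda>b. act c 1 (lie_pol E b)) x"
      by (rule frag_extend_eq) (simp add: act)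
    also have "\<dots> = act c 1 (frag_extend (lie_pol E) x)"
      by (simp add: act_def frag_extend_comp)
    also have "\<dots> = 0" using E(4) by (simp add: act_zero)
    finally have "frag_extend (lie_pol (insert c E)) x = 0" .
    moreover have "card (insert c E) = Suc k" using c(1) finE E(2) by auto
    moreover have "a \<in> insert c E" if "e \<in> insert c E" "basic m r a" "(a, e) \<in> r" for a e
      using that E(3) Ec by blast
    ultimately show ?case using E(1) c(1) by (intro exI[of _ "insert c E"]) auto
  qed
  from this[of "card ?B"] obtain E where E: "E \<subseteq> ?B" "card E = card ?B" "frag_extend (lie_pol E) x = 0"
    by blast
  then have EB: "E = ?B" using card_subset_eq[OF finite_basic_wt_less] by blast
  \<comment> \<open>Right entries of commutators of weight \<open>w\<close> have smaller weight,
    hence now lie in \<open>E\<close>.\<close>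
  have "lie_pol E b = var b" if "b \<in> Poly_Mapping.keys x" for b
  proof (cases b)
    case (Comm e a)
    then have "a \<in> E" using that x wt_pos[of e] unfolding EB by (auto elim: basic_CommE)
    then show ?thesis using Comm by simp
  qed auto
  then have "frag_extend var x = 0" using E(3) frag_extend_eq by (metis (no_types, lifting))
  \<comment> \<open>Reading off the only letter of a one-letter word recovers
    \<open>x\<close>.\<close>
  moreover have "frag_extend (\<lambda>w. frag_of (hd (letters w))) (frag_extend var x) = x"
    by (simp add: frag_extend_comp mon_def flip: frag_expansion)
  ultimately show ?thesis by simp
qed

section \<open>Commutator calculus\<close>

context group
begin

lemma cancel_inv_left: "x \<in> carrier G \<Longrightarrow> y \<in> carrier G \<Longrightarrow> x \<otimes> (inv x \<otimes> y) = y"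
  by (simp flip: m_assoc)

lemma cancel_inv_left': "x \<in> carrier G \<Longrightarrow> y \<in> carrier G \<Longrightarrow> inv x \<otimes> (x \<otimes> y) = y"
  by (simp flip: m_assoc)

text \<open>These rules rewrite to freely reduced, right-nested words, so identities valid in all
  groups, such as \<open>Hall_Witt\<close>, follow by comparing normal forms.\<close>

lemmas word_simps = gcomm_def m_assoc inv_mult_group cancel_inv_left cancel_inv_left'

lemma gcomm_closed [simp, intro]:
  "x \<in> carrier G \<Longrightarrow> y \<in> carrier G \<Longrightarrow> gcomm G x y \<in> carrier G"
  by (simp add: gcomm_def)

lemma gcomm_mult_left:
  "\<lbrakk>x \<in> carrier G; y \<in> carrier G; z \<in> carrier G\<rbrakk> \<Longrightarrow>
   gcomm G (x \<otimes> y) z = inv y \<otimes> gcomm G x z \<otimes> y \<otimes> gcomm G y z"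
  by (simp add: word_simps)

lemma gcomm_inv_left:
  "\<lbrakk>x \<in> carrier G; z \<in> carrier G\<rbrakk> \<Longrightarrow>
   gcomm G (inv x) z = x \<otimes> inv (gcomm G x z) \<otimes> inv x"
  by (simp add: word_simps)

lemma inv_gcomm:
  "\<lbrakk>x \<in> carrier G; y \<in> carrier G\<rbrakk> \<Longrightarrow> inv (gcomm G x y) = gcomm G y x"
  by (simp add: word_simps)

lemma gcomm_self: "x \<in> carrier G \<Longrightarrow> gcomm G x x = \<one>"
  by (simp add: word_simps)

lemma mult_gcomm:
  "\<lbrakk>x \<in> carrier G; y \<in> carrier G\<rbrakk> \<Longrightarrow> y \<otimes> x \<otimes> gcomm G x y = x \<otimes> y"
  by (simp add: word_simps)

lemma conj_gcomm:
  "\<lbrakk>g \<in> carrier G; x \<in> carrier G; y \<in> carrier G\<rbrakk> \<Longrightarrow>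
   g \<otimes> gcomm G x y \<otimes> inv g = gcomm G (g \<otimes> x \<otimes> inv g) (g \<otimes> y \<otimes> inv g)"
  by (simp add: word_simps)

lemma Hall_Witt:
  assumes "x \<in> carrier G" "y \<in> carrier G" "z \<in> carrier G"
  shows "(inv y \<otimes> gcomm G (gcomm G x (inv y)) z \<otimes> y)
       \<otimes> (inv z \<otimes> gcomm G (gcomm G y (inv z)) x \<otimes> z)
       \<otimes> (inv x \<otimes> gcomm G (gcomm G z (inv x)) y \<otimes> x) = \<one>"
  using assms by (simp add: word_simps)

text \<open>By \<open>[xy, z] = y^-1 [x, z] y [y, z]\<close>, closure requires conjugation by
  elements of \<open>H\<close> only. The subgroup playing \<open>K\<close> in
  \<open>comm_sub_gamma_generated\<close> is known there to be normalized by
  \<open>gamma G s\<close>, not by all of \<open>G\<close>.\<close>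

lemma subgroup_gcomm_left_in:
  assumes K: "subgroup K G" and H: "subgroup H G" and z: "z \<in> H"
    and conj: "\<And>h k. h \<in> H \<Longrightarrow> k \<in> K \<Longrightarrow> h \<otimes> k \<otimes> inv h \<in> K"
  shows "subgroup {t \<in> H. gcomm G t z \<in> K} G"
proof (rule subgroupI)
  interpret K: subgroup K G by (rule K)
  interpret H: subgroup H G by (rule H)
  show "{t \<in> H. gcomm G t z \<in> K} \<subseteq> carrier G" by auto
  have "gcomm G \<one> z = \<one>" using z by (simp add: word_simps)
  then show "{t \<in> H. gcomm G t z \<in> K} \<noteq> {}"
    using K.one_closed H.one_closed by (metis (mono_tags, lifting) empty_iff mem_Collect_eq)
  fix a assume a: "a \<in> {t \<in> H. gcomm G t z \<in> K}"
  then show "inv a \<in> {t \<in> H. gcomm G t z \<in> K}"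
    using z conj by (auto simp: gcomm_inv_left)
  fix b assume b: "b \<in> {t \<in> H. gcomm G t z \<in> K}"
  then have "inv b \<otimes> gcomm G a z \<otimes> b \<in> K" using conj[of "inv b" "gcomm G a z"] a by auto
  then show "a \<otimes> b \<in> {t \<in> H. gcomm G t z \<in> K}"
    using a b z by (auto simp: gcomm_mult_left)
qed

lemma subgroup_gcomm_left:
  assumes K: "K \<lhd> G" and z: "z \<in> carrier G"
  shows "subgroup {t \<in> carrier G. gcomm G t z \<in> K} G"
  by (rule subgroup_gcomm_left_in[OF normal_imp_subgroup[OF K] subgroup_self z])
     (rule normal.inv_op_closed2[OF K])

lemma gcomm_swap_mem:
  assumes "subgroup K G" "x \<in> carrier G" "y \<in> carrier G" "gcomm G x y \<in> K"
  shows "gcomm G y x \<in> K"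
  using assms inv_gcomm[of x y] subgroup.m_inv_closed by metis

lemma gcomm_mem_inv_left:
  assumes "K \<lhd> G" "x \<in> carrier G" "z \<in> carrier G" "gcomm G x z \<in> K"
  shows "gcomm G (inv x) z \<in> K"
  using subgroup.m_inv_closed[OF subgroup_gcomm_left[OF assms(1,3)], of x] assms by auto

lemma gcomm_mem_inv_right:
  assumes "K \<lhd> G" "x \<in> carrier G" "z \<in> carrier G" "gcomm G x z \<in> K"
  shows "gcomm G x (inv z) \<in> K"
  using assms gcomm_mem_inv_left gcomm_swap_mem normal_imp_subgroup by (metis inv_closed)

lemma gcomm_mem_generate_left:
  assumes K: "K \<lhd> G" and z: "z \<in> carrier G" and S: "S \<subseteq> carrier G"
    and mem: "\<And>s. s \<in> S \<Longrightarrow> gcomm G s z \<in> K" and t: "t \<in> generate G S"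
  shows "gcomm G t z \<in> K"
  using generate_subgroup_incl[OF _ subgroup_gcomm_left[OF K z], of S] S mem t by blast

lemma gcomm_mem_generate_right:
  assumes K: "K \<lhd> G" and z: "z \<in> carrier G" and S: "S \<subseteq> carrier G"
    and mem: "\<And>s. s \<in> S \<Longrightarrow> gcomm G z s \<in> K" and t: "t \<in> generate G S"
  shows "gcomm G z t \<in> K"
proof -
  have KS: "subgroup K G" using K by (rule normal_imp_subgroup)
  have "gcomm G t z \<in> K"
    using gcomm_mem_generate_left[OF K z S _ t] gcomm_swap_mem[OF KS z] mem S by blast
  then show ?thesis
    using gcomm_swap_mem[OF KS _ z] generate_in_carrier[OF S t] by blast
qed

text \<open>Element form of the three subgroups lemma: in the Hall-Witt identity for
  \<open>x\<close>, \<open>inv y\<close>, \<open>z\<close> two of the three conjugated factors lie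
  in \<open>K\<close>, hence so does the third.\<close>

lemma three_subgroups_mem:
  assumes K: "K \<lhd> G" and c: "x \<in> carrier G" "y \<in> carrier G" "z \<in> carrier G"
    and 1: "gcomm G (gcomm G (inv y) (inv z)) x \<in> K"
    and 2: "gcomm G (gcomm G z (inv x)) (inv y) \<in> K"
  shows "gcomm G (gcomm G x y) z \<in> K"
proof -
  interpret K: normal K G by (rule K)
  let ?A = "inv (inv y) \<otimes> gcomm G (gcomm G x (inv (inv y))) z \<otimes> inv y"
  let ?B = "inv z \<otimes> gcomm G (gcomm G (inv y) (inv z)) x \<otimes> z"
  let ?C = "inv x \<otimes> gcomm G (gcomm G z (inv x)) (inv y) \<otimes> x"
  have K': "?B \<in> K" "?C \<in> K" using c 1 2 K.inv_op_closed1 by auto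
  have "?A \<otimes> (?B \<otimes> ?C) = \<one>"
    using Hall_Witt[of x "inv y" z] c by (simp add: m_assoc)
  then have "?A = inv (?B \<otimes> ?C)"
    using c by (intro inv_equality[symmetric]) auto
  also have "\<dots> \<in> K" by (rule K.m_inv_closed[OF K.m_closed[OF K']])
  finally have "y \<otimes> gcomm G (gcomm G x y) z \<otimes> inv y \<in> K" using c by simp
  from K.inv_op_closed1[OF c(2) this] show ?thesis using c by (simp add: m_assoc cancel_inv_left')
qed

lemma gcomm_mem_normal_left:
  assumes "K \<lhd> G" "x \<in> K" "y \<in> carrier G"
  shows "gcomm G x y \<in> K"
proof -
  interpret K: normal K G by (rule assms)
  have "gcomm G x y = inv x \<otimes> (inv y \<otimes> x \<otimes> y)" using assms by (simp add: gcomm_def m_assoc)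
  then show ?thesis using assms K.inv_op_closed1 by simp
qed

lemma comm_sub_normal:
  assumes "H \<lhd> G" "K \<lhd> G"
  shows "comm_sub G H K \<lhd> G"
  unfolding comm_sub_def
proof (rule normal_generateI)
  interpret H: normal H G by fact
  interpret K: normal K G by fact
  show "{gcomm G h k |h k. h \<in> H \<and> k \<in> K} \<subseteq> carrier G" by auto
  fix x g assume "x \<in> {gcomm G h k |h k. h \<in> H \<and> k \<in> K}" and g: "g \<in> carrier G"
  then obtain h k where hk: "h \<in> H" "k \<in> K" "x = gcomm G h k" by auto
  have "g \<otimes> h \<otimes> inv g \<in> H" "g \<otimes> k \<otimes> inv g \<in> K"
    using hk g H.inv_op_closed2 K.inv_op_closed2 by auto
  then show "g \<otimes> x \<otimes> inv g \<in> {gcomm G h k |h k. h \<in> H \<and> k \<in> K}"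
    using hk g by (auto simp: conj_gcomm)
qed

lemma gcomm_in_comm_sub: "h \<in> H \<Longrightarrow> k \<in> K \<Longrightarrow> gcomm G h k \<in> comm_sub G H K"
  unfolding comm_sub_def by (rule generate.incl) auto

lemma comm_sub_least:
  assumes "subgroup L G" "\<And>h k. h \<in> H \<Longrightarrow> k \<in> K \<Longrightarrow> gcomm G h k \<in> L"
  shows "comm_sub G H K \<subseteq> L"
  unfolding comm_sub_def using assms by (intro generate_subgroup_incl) auto

section \<open>The lower central series as a filtration\<close>

lemma carrier_normal: "carrier G \<lhd> G"
  by (rule normal_invI) (auto intro: subgroup_self)

lemma gamma_Suc: "1 \<le> k \<Longrightarrow> gamma G (Suc k) = comm_sub G (gamma G k) (carrier G)"
  by (cases k) auto

lemma gamma_normal: "gamma G k \<lhd> G"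
proof (induction k)
  case (Suc k)
  then show ?case
    by (cases "k = 0") (auto simp: gamma_Suc intro: comm_sub_normal carrier_normal)
qed (auto intro: carrier_normal)

lemma gamma_subgroup: "subgroup (gamma G k) G"
  by (rule normal_imp_subgroup[OF gamma_normal])

lemma gamma_carrier: "x \<in> gamma G k \<Longrightarrow> x \<in> carrier G"
  using subgroup.mem_carrier[OF gamma_subgroup] .

lemma gamma_Suc_subset: "gamma G (Suc k) \<subseteq> gamma G k"
proof (cases "k = 0")
  case False
  then show ?thesis
    by (simp add: gamma_Suc comm_sub_least gamma_subgroup gcomm_mem_normal_left gamma_normal)
qed auto

lemma gamma_antimono: "j \<le> k \<Longrightarrow> gamma G k \<subseteq> gamma G j"
  by (rule lift_Suc_antimono_le[of "gamma G"]) (rule gamma_Suc_subset)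

text \<open>Induction on \<open>b\<close> with \<open>a\<close> free. For \<open>y = [u, v]\<close>
  with \<open>u\<close> in \<open>gamma G b\<close>, the three subgroups lemma asks for
  \<open>[[v^-1, x^-1], u]\<close>, where the hypothesis is used at \<open>a + 1\<close>, and for
  \<open>[[x, u^-1], v^-1]\<close>, where it is used at \<open>a\<close>.\<close>

lemma gcomm_gamma:
  assumes "1 \<le> a" "1 \<le> b" "x \<in> gamma G a" "y \<in> gamma G b"
  shows "gcomm G x y \<in> gamma G (a + b)"
  using assms(2,1,3,4)
proof (induction b arbitrary: a x y rule: dec_induct)
  case base
  then show ?case using gcomm_in_comm_sub by (simp add: gamma_Suc)
next
  case (step b)
  let ?K = "gamma G (a + Suc b)"
  have x: "x \<in> carrier G" using step by (auto intro: gamma_carrier)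
  have "gcomm G x y \<in> ?K"
  proof (rule gcomm_mem_generate_right[OF gamma_normal x])
    show "y \<in> generate G {gcomm G h k |h k. h \<in> gamma G b \<and> k \<in> carrier G}"
      using step by (simp add: gamma_Suc comm_sub_def)
    show "{gcomm G h k |h k. h \<in> gamma G b \<and> k \<in> carrier G} \<subseteq> carrier G"
      by (auto intro: gamma_carrier)
    fix s assume "s \<in> {gcomm G h k |h k. h \<in> gamma G b \<and> k \<in> carrier G}"
    then obtain u v where s: "s = gcomm G u v" and u: "u \<in> gamma G b" and v: "v \<in> carrier G" by auto
    have uc: "u \<in> carrier G" using u by (rule gamma_carrier)
    have "gcomm G (inv x) (inv v) \<in> gamma G (Suc a)"
      using step v subgroup.m_inv_closed[OF gamma_subgroup]
      by (auto simp: gamma_Suc intro!: gcomm_in_comm_sub)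
    then have "gcomm G (inv v) (inv x) \<in> gamma G (Suc a)"
      using gcomm_swap_mem[OF gamma_subgroup] x v by auto
    then have 1: "gcomm G (gcomm G (inv v) (inv x)) u \<in> ?K"
      using step.IH[OF _ _ u] by (metis add_Suc_right add_Suc le_add1 plus_1_eq_Suc)
    have "gcomm G x (inv u) \<in> gamma G (a + b)"
      using step u subgroup.m_inv_closed[OF gamma_subgroup] by auto
    then have 2: "gcomm G (gcomm G x (inv u)) (inv v) \<in> ?K"
      using step v gcomm_in_comm_sub by (simp add: gamma_Suc)
    have "gcomm G s x \<in> ?K"
      unfolding s by (rule three_subgroups_mem[OF gamma_normal uc v x 1 2])
    then show "gcomm G x s \<in> ?K"
      using gcomm_swap_mem[OF gamma_subgroup] x uc v s by auto
  qed
  then show ?case .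
qed

text \<open>Conjugation by \<open>g\<close> moves \<open>h\<close> by the factor
  \<open>[h, g^-1]\<close>, which lies in \<open>gamma G (Suc j)\<close>: the factors of the series
  are central.\<close>

lemma normal_between_gamma:
  assumes K: "subgroup K G" and j: "1 \<le> j" "K \<subseteq> gamma G j" "gamma G (Suc j) \<subseteq> K"
  shows "K \<lhd> G"
proof (rule normal_invI[OF K])
  fix g h assume g: "g \<in> carrier G" and h: "h \<in> K"
  have hc: "h \<in> carrier G" using subgroup.mem_carrier[OF K h] .
  have "gcomm G h (inv g) \<in> K"
    using j h g gcomm_in_comm_sub[of h "gamma G j" "inv g" "carrier G"] by (auto simp: gamma_Suc)
  then have "h \<otimes> gcomm G h (inv g) \<in> K" using h subgroup.m_closed[OF K] by auto
  then show "g \<otimes> h \<otimes> inv g \<in> K" using g hc by (simp add: word_simps)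
qed

text \<open>The set contains \<open>gamma G (Suc j)\<close> by weight, so it is sandwiched between
  consecutive terms of the series. Its normality lets \<open>Jacobi_mem\<close> replace entries by
  their inverses.\<close>

lemma normal_gcomm_left_gamma:
  assumes j: "1 \<le> j" "1 \<le> k" and w: "w \<in> gamma G k"
    and K: "K \<lhd> G" "gamma G (Suc (j + k)) \<subseteq> K"
  shows "{t \<in> carrier G. gcomm G t w \<in> K} \<inter> gamma G j \<lhd> G" (is "?T \<lhd> G")
proof (rule normal_between_gamma[OF _ j(1)])
  show "subgroup ?T G"
    by (intro subgroups_Inter_pair subgroup_gcomm_left K gamma_subgroup gamma_carrier[OF w])
  show "gamma G (Suc j) \<subseteq> ?T"
  proof
    fix t assume t: "t \<in> gamma G (Suc j)"
    have "gcomm G t w \<in> gamma G (Suc j + k)" using gcomm_gamma[OF _ _ t w] j by auto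
    then have "gcomm G t w \<in> K" using K(2) by auto
    then show "t \<in> ?T" using t gamma_Suc_subset gamma_carrier[OF t] by blast
  qed
qed auto

text \<open>Since \<open>K\<close> contains everything of weight above \<open>a + b + c\<close>,
  inverting an entry of a triple commutator does not affect membership in \<open>K\<close>, so the
  Hall-Witt identity acts as the Jacobi identity.\<close>

lemma Jacobi_mem:
  assumes abc: "1 \<le> a" "1 \<le> b" "1 \<le> c"
    and x: "x \<in> gamma G a" and y: "y \<in> gamma G b" and z: "z \<in> gamma G c"
    and K: "K \<lhd> G" "gamma G (Suc (a + b + c)) \<subseteq> K"
    and 1: "gcomm G (gcomm G y z) x \<in> K" and 2: "gcomm G (gcomm G x z) y \<in> K"
  shows "gcomm G (gcomm G x y) z \<in> K"
proof -
  note car = x[THEN gamma_carrier] y[THEN gamma_carrier] z[THEN gamma_carrier]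
  \<comment> \<open>A normal subgroup containing \<open>[y, z]\<close> also contains the commutator
    with both entries inverted.\<close>
  let ?T = "{t \<in> carrier G. gcomm G t x \<in> K} \<inter> gamma G (b + c)"
  have T: "?T \<lhd> G"
    using abc K by (intro normal_gcomm_left_gamma[OF _ _ x]) (auto simp: add_ac)
  have "gcomm G y z \<in> ?T" using 1 gcomm_gamma[OF _ _ y z] abc car by auto
  then have "gcomm G (inv y) z \<in> ?T" by (rule gcomm_mem_inv_left[OF T car(2,3)])
  then have "gcomm G (inv y) (inv z) \<in> ?T" by (rule gcomm_mem_inv_right[OF T inv_closed[OF car(2)] car(3)])
  then have yzx: "gcomm G (gcomm G (inv y) (inv z)) x \<in> K" by blast
  let ?T' = "{t \<in> carrier G. gcomm G t y \<in> K} \<inter> gamma G (a + c)"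
  have T': "?T' \<lhd> G"
    using abc K by (intro normal_gcomm_left_gamma[OF _ _ y]) (auto simp: add_ac)
  have "gcomm G x z \<in> ?T'" using 2 gcomm_gamma[OF _ _ x z] abc car by auto
  then have "gcomm G (inv x) z \<in> ?T'" by (rule gcomm_mem_inv_left[OF T' car(1,3)])
  then have "gcomm G z (inv x) \<in> ?T'"
    by (rule gcomm_swap_mem[OF normal_imp_subgroup[OF T'] inv_closed[OF car(1)] car(3)])
  then have "gcomm G (gcomm G z (inv x)) y \<in> K" by blast
  then have "gcomm G (gcomm G z (inv x)) (inv y) \<in> K"
    using gcomm_mem_inv_right[OF K(1) _ car(2)] car by simp
  with yzx show ?thesis by (rule three_subgroups_mem[OF K(1) car])
qed

end

section \<open>Basic commutators generate the lower central factors\<close>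

locale basic_commutators = group G for G (structure) +
  fixes m :: nat and r :: "(cterm \<times> cterm) set" and ev :: "cterm \<Rightarrow> 'a"
  assumes order: "admissible_order r"
    and ev_Gen: "\<And>i. 1 \<le> i \<Longrightarrow> i \<le> m \<Longrightarrow> ev (Gen i) \<in> carrier G"
    and ev_Comm: "\<And>b a. ev (Comm b a) = gcomm G (ev b) (ev a)"
    and gens: "carrier G \<subseteq> generate G (ev ` Gen ` {1..m})"
begin

lemma ev_gamma: "basic m r b \<Longrightarrow> ev b \<in> gamma G (wt b)"
proof (induction rule: basic.induct)
  case (gen i)
  then show ?case using ev_Gen by simp
next
  case (comm b a)
  then show ?case
    using gcomm_gamma[of "wt b" "wt a"] wt_pos[of b] wt_pos[of a] by (simp add: ev_Comm)
qed

lemma ev_carrier: "basic m r b \<Longrightarrow> ev b \<in> carrier G"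
  using ev_gamma gamma_carrier by blast

text \<open>Adjoining \<open>gamma G (Suc k)\<close> lets generated subgroups stand for spans in the
  quotient of \<open>gamma G k\<close> by \<open>gamma G (Suc k)\<close>.\<close>

definition level :: "nat \<Rightarrow> 'a set" where
  "level k = ev ` {b. basic m r b \<and> wt b = k} \<union> gamma G (Suc k)"

lemma level_subset_gamma: "level k \<subseteq> gamma G k"
  using ev_gamma gamma_Suc_subset unfolding level_def by auto

lemma level_carrier: "level k \<subseteq> carrier G"
  using level_subset_gamma gamma_carrier by blast

lemma generate_level_subgroup: "subgroup (generate G (level k)) G"
  by (rule generate_is_subgroup[OF level_carrier])

lemma gamma_Suc_subset_level: "gamma G (Suc k) \<subseteq> generate G (level k)"
  by (auto simp: level_def intro: generate.incl)

lemma generate_level_normal: "1 \<le> k \<Longrightarrow> generate G (level k) \<lhd> G"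
  by (rule normal_between_gamma[OF generate_level_subgroup])
     (auto intro: generate_subgroup_incl[OF level_subset_gamma gamma_subgroup, THEN subsetD]
        gamma_Suc_subset_level[THEN subsetD])

text \<open>Descending induction on the smaller entry \<open>a\<close>. If \<open>[[b1, b2], a]\<close> is not basic, then
  \<open>a < b2 < b1\<close>, and the Jacobi identity expresses it by brackets both of whose entries exceed \<open>a\<close>,
  because terms of larger weight are larger.\<close>

lemma gcomm_basics_mem_level:
  assumes span: "\<And>j. 1 \<le> j \<Longrightarrow> j < k \<Longrightarrow> gamma G j \<subseteq> generate G (level j)"
    and ab: "basic m r b" "basic m r a" "wt b + wt a = k"
  shows "gcomm G (ev b) (ev a) \<in> generate G (level k)"
proof -
  let ?K = "generate G (level k)"
  let ?B = "{b. basic m r b \<and> wt b < k}"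
  have k: "1 \<le> k" using ab wt_pos[of a] by linarith
  note K = generate_level_normal[OF k] and KS = generate_level_subgroup[of k]
  \<comment> \<open>The order is reversed, so that well-founded induction starts at the largest
    entries.\<close>
  let ?R = "{(x, y). x \<in> ?B \<and> y \<in> ?B \<and> (y, x) \<in> r}"
  have "trans ?R" using admissible_trans[OF order] unfolding trans_def by blast
  then have "acyclic ?R"
    using admissible_irrefl[OF order] by (auto simp: acyclic_irrefl irrefl_def trancl_id)
  then have "wf ?R"
    by (intro finite_acyclic_wf) (auto intro: finite_subset[of _ "?B \<times> ?B"] simp: finite_basic_wt_less)
  then have ordered: "\<forall>b. basic m r b \<longrightarrow> (a, b) \<in> r \<longrightarrow> wt b + wt a = k \<longrightarrow> gcomm G (ev b) (ev a) \<in> ?K"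
    if "a \<in> ?B" for a
    using that
  proof (induction a rule: wf_induct_rule)
    case (less a)
    have any: "gcomm G (ev e) (ev f) \<in> ?K"
      if e: "basic m r e" "(a, e) \<in> r" and f: "basic m r f" "(a, f) \<in> r" and ef: "wt e + wt f = k" for e f
    proof -
      have B: "e \<in> ?B" "f \<in> ?B" using e f ef wt_pos[of e] wt_pos[of f] by auto
      consider "e = f" | "(e, f) \<in> r" | "(f, e) \<in> r" using admissible_total[OF order] by blast
      then show ?thesis
      proof cases
        case 1
        then show ?thesis using gcomm_self[OF ev_carrier[OF e(1)]] generate.one by simp
      next
        case 2
        then have "gcomm G (ev f) (ev e) \<in> ?K" using less B e f ef by (simp add: add.commute)
        then show ?thesis using gcomm_swap_mem[OF KS] ev_carrier e f by blast
      next
        case 3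
        then show ?thesis using less B e f ef by simp
      qed
    qed
    \<comment> \<open>Modulo deeper elements, \<open>t\<close> is a product of basic commutators of
      weight \<open>j\<close>, all larger than \<open>a\<close> because \<open>wt a < j\<close>, and
      their inverses. The deeper elements contribute only to \<open>gamma G (Suc k)\<close>.\<close>
    have gen: "gcomm G t (ev f) \<in> ?K"
      if t: "t \<in> gamma G j" and j: "wt a < j" and f: "basic m r f" "(a, f) \<in> r" and jf: "j + wt f = k" for t j f
    proof (rule gcomm_mem_generate_left[OF K ev_carrier[OF f(1)] level_carrier])
      show "t \<in> generate G (level j)" using span[of j] t j jf wt_pos[of f] by auto
      fix s assume "s \<in> level j"
      then consider e where "s = ev e" "basic m r e" "wt e = j" | "s \<in> gamma G (Suc j)"
        by (auto simp: level_def)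
      then show "gcomm G s (ev f) \<in> ?K"
      proof cases
        case 1
        then show ?thesis using any f j jf admissible_wt[OF order] by simp
      next
        case 2
        then have "gcomm G s (ev f) \<in> gamma G (Suc j + wt f)"
          using gcomm_gamma[OF _ _ 2 ev_gamma[OF f(1)]] wt_pos[of f] by simp
        then show ?thesis using gamma_Suc_subset_level jf by auto
      qed
    qed
    show ?case
    proof (intro allI impI)
      fix b assume b: "basic m r b" "(a, b) \<in> r" "wt b + wt a = k"
      have a: "basic m r a" using less by simp
      show "gcomm G (ev b) (ev a) \<in> ?K"
      proof (cases "basic m r (Comm b a)")
        case True
        then have "ev (Comm b a) \<in> ?K" using b by (intro generate.incl) (auto simp: level_def)
        then show ?thesis by (simp add: ev_Comm)
      next
        case False
        then obtain b1 b2 where bb: "b = Comm b1 b2" "b2 \<noteq> a" "(b2, a) \<notin> r"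
          using basic.comm[OF b(1) a b(2)] by blast
        then have bs: "basic m r b1" "basic m r b2" "(b2, b1) \<in> r"
          using b(1) by (auto elim: basic_CommE)
        have ab2: "(a, b2) \<in> r" using bb admissible_total[OF order] by blast
        then have ab1: "(a, b1) \<in> r" using bs(3) admissible_trans[OF order] by blast
        have wk: "wt b1 + wt b2 + wt a = k" using b bb by simp
        note pos = wt_pos[of a] wt_pos[of b1] wt_pos[of b2]
        have "gcomm G (ev b2) (ev a) \<in> gamma G (wt b2 + wt a)"
          "gcomm G (ev b1) (ev a) \<in> gamma G (wt b1 + wt a)"
          using gcomm_gamma ev_gamma bs a pos by auto
        then have "gcomm G (gcomm G (ev b2) (ev a)) (ev b1) \<in> ?K"
          "gcomm G (gcomm G (ev b1) (ev a)) (ev b2) \<in> ?K"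
          using gen bs ab1 ab2 wk pos by (auto simp: add_ac)
        then have "gcomm G (gcomm G (ev b1) (ev b2)) (ev a) \<in> ?K"
          using gamma_Suc_subset_level[of k] wk pos
          by (intro Jacobi_mem[OF _ _ _ ev_gamma[OF bs(1)] ev_gamma[OF bs(2)] ev_gamma[OF a] K]) auto
        then show ?thesis by (simp add: bb ev_Comm)
      qed
    qed
  qed
  have B: "a \<in> ?B" "b \<in> ?B" using ab wt_pos[of a] wt_pos[of b] by auto
  consider "a = b" | "(a, b) \<in> r" | "(b, a) \<in> r" using admissible_total[OF order] by blast
  then show ?thesis
  proof cases
    case 1
    then show ?thesis using gcomm_self[OF ev_carrier[OF ab(1)]] generate.one by simp
  next
    case 2
    then show ?thesis using ordered B ab by simp
  next
    case 3
    then have "gcomm G (ev a) (ev b) \<in> ?K" using ordered B ab by (simp add: add.commute)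
    then show ?thesis using gcomm_swap_mem[OF KS] ev_carrier ab by blast
  qed
qed

text \<open>Strong induction, since \<open>gcomm_basics_mem_level\<close> needs spanning in every
  smaller weight. In a generator \<open>[g, x]\<close> of \<open>gamma G k\<close> the entry
  \<open>g\<close> is reduced to basic commutators of weight \<open>k - 1\<close> and
  \<open>x\<close> to the given generators.\<close>

lemma gamma_subset_level: "1 \<le> k \<Longrightarrow> gamma G k \<subseteq> generate G (level k)"
proof (induction k rule: less_induct)
  case (less k)
  let ?K = "generate G (level k)"
  note K = generate_level_normal[OF less.prems]
  show ?case
  proof (cases "k = 1")
    case True
    have "ev ` Gen ` {1..m} \<subseteq> level k"
      using True by (auto simp: level_def intro!: imageI basic.gen)
    from mono_generate[OF this] show ?thesis using gens True by auto
  next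
    case False
    then obtain j where j: "k = Suc j" "1 \<le> j" using less.prems by (cases k) auto
    have "gcomm G g x \<in> ?K" if g: "g \<in> gamma G j" and x: "x \<in> carrier G" for g x
    proof (rule gcomm_mem_generate_left[OF K x level_carrier])
      show "g \<in> generate G (level j)" using less.IH[of j] j g by auto
      fix s assume "s \<in> level j"
      then consider b where "s = ev b" "basic m r b" "wt b = j" | "s \<in> gamma G (Suc j)"
        by (auto simp: level_def)
      then show "gcomm G s x \<in> ?K"
      proof cases
        case 1
        show ?thesis
        proof (rule gcomm_mem_generate_right[OF K])
          show "x \<in> generate G (ev ` Gen ` {1..m})" using gens x by auto
          show "s \<in> carrier G" using 1 ev_carrier by simp
          show "ev ` Gen ` {1..m} \<subseteq> carrier G" using ev_Gen by auto
          fix y assume "y \<in> ev ` Gen ` {1..m}"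
          then obtain i where i: "y = ev (Gen i)" "1 \<le> i" "i \<le> m" by auto
          then show "gcomm G s y \<in> ?K"
            using gcomm_basics_mem_level[OF _ 1(2) basic.gen, of k i] less.IH 1 j by simp
        qed
      next
        case 2
        then have "gcomm G s x \<in> gamma G (Suc k)"
          using j x by (auto simp: gamma_Suc[of k] intro!: gcomm_in_comm_sub)
        then show ?thesis using gamma_Suc_subset_level by auto
      qed
    qed
    then show ?thesis
      unfolding j(1) gamma_Suc[OF j(2)]
      using generate_level_subgroup[of k] by (intro comm_sub_least) (auto simp: j)
  qed
qed

lemma gamma_subset_generate_basics:
  assumes "1 \<le> j" "j \<le> k"
  shows "gamma G j \<subseteq> generate G (ev ` {b. basic m r b \<and> j \<le> wt b \<and> wt b < k} \<union> gamma G k)"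
  using assms(2)
proof (induction k rule: dec_induct)
  case base
  show ?case by (auto intro: generate.incl)
next
  case (step k)
  let ?S = "ev ` {b. basic m r b \<and> j \<le> wt b \<and> wt b < Suc k} \<union> gamma G (Suc k)"
  have S: "subgroup (generate G ?S) G"
    by (rule generate_is_subgroup) (auto intro: ev_carrier gamma_carrier)
  have "level k \<subseteq> ?S" using step by (auto simp: level_def)
  then have "gamma G k \<subseteq> generate G ?S"
    using gamma_subset_level[of k] mono_generate[of "level k" ?S] step assms(1) by auto
  then have "ev ` {b. basic m r b \<and> j \<le> wt b \<and> wt b < k} \<union> gamma G k \<subseteq> generate G ?S"
    by (auto intro!: generate.incl)
  from generate_subgroup_incl[OF this S] show ?case using step.IH by blast
qed

end

section \<open>The free group and its Magnus expansion\<close>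

lemma letter_inv_invol [simp]: "letter_inv (letter_inv l) = l"
  by (cases l) auto

lemma fst_letter_inv [simp]: "fst (letter_inv l) = fst l"
  by (cases l) auto

lemma reduced_ConsD: "reduced (x # w) \<Longrightarrow> reduced w"
  by (cases w) auto

lemma reduced_red_cons: "reduced w \<Longrightarrow> reduced (red_cons l w)"
  by (cases w) (auto dest: reduced_ConsD)

lemma red_cons_reduced: "reduced (x # w) \<Longrightarrow> red_cons x w = x # w"
  by (cases w) auto

text \<open>Van der Waerden's argument: letters act on reduced words, inverse letters acting
  inversely. \<open>reduce\<close> evaluates this action at the empty word, which is how
  associativity is obtained.\<close>

lemma red_cons_inv: "reduced w \<Longrightarrow> red_cons l (red_cons (letter_inv l) w) = w"
  by (cases w) (auto simp: red_cons_reduced)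

lemma set_red_cons: "set (red_cons l w) \<subseteq> insert l (set w)"
  by (cases w) auto

lemma reduced_foldr: "reduced w \<Longrightarrow> reduced (foldr red_cons xs w)"
  by (induction xs) (auto intro: reduced_red_cons)

lemma reduced_reduce: "reduced (reduce xs)"
  by (simp add: reduce_def reduced_foldr)

lemma set_reduce: "set (reduce xs) \<subseteq> set xs"
  unfolding reduce_def by (induction xs) (use set_red_cons in fastforce)+

lemma reduce_reduced: "reduced w \<Longrightarrow> reduce w = w"
proof (induction w)
  case (Cons x w)
  then have "reduce w = w" by (auto dest: reduced_ConsD)
  then show ?case using red_cons_reduced[OF Cons.prems] by (simp add: reduce_def)
qed (simp add: reduce_def)

lemma reduce_append: "reduce (xs @ ys) = foldr red_cons xs (reduce ys)"
  by (simp add: reduce_def)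

lemma foldr_red_cons:
  "reduced w \<Longrightarrow> foldr red_cons (red_cons x ys) w = red_cons x (foldr red_cons ys w)"
  by (cases ys) (auto simp: red_cons_inv reduced_foldr)

lemma foldr_reduce: "reduced w \<Longrightarrow> foldr red_cons (reduce xs) w = foldr red_cons xs w"
  by (induction xs) (auto simp: reduce_def foldr_red_cons)

lemma reduce_append_reduce_left: "reduce (reduce xs @ ys) = reduce (xs @ ys)"
  by (simp add: reduce_append foldr_reduce reduced_reduce)

lemma reduce_append_reduce_right: "reduce (xs @ reduce ys) = reduce (xs @ ys)"
  by (simp add: reduce_append reduce_reduced reduced_reduce)

lemma reduce_inverse: "reduce (rev (map letter_inv w) @ w) = []"
proof (induction w)
  case (Cons x w)
  have "red_cons (letter_inv x) (red_cons x (reduce w)) = reduce w"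
    using red_cons_inv[OF reduced_reduce, of "letter_inv x" w] by simp
  then show ?case using Cons by (simp add: reduce_append) (simp add: reduce_def)
qed (simp add: reduce_def)

lemma carrier_free_group_on:
  "carrier (free_group_on m) = {w. reduced w \<and> (\<forall>l\<in>set w. fst l \<in> {1..m})}"
  by (simp add: free_group_on_def)

lemma mult_free_group_on: "x \<otimes>\<^bsub>free_group_on m\<^esub> y = reduce (x @ y)"
  by (simp add: free_group_on_def)

lemma one_free_group_on: "\<one>\<^bsub>free_group_on m\<^esub> = []"
  by (simp add: free_group_on_def)

lemma reduce_in_free_group_on:
  "(\<forall>l\<in>set w. fst l \<in> {1..m}) \<Longrightarrow> reduce w \<in> carrier (free_group_on m)"
  using set_reduce[of w] by (auto simp: carrier_free_group_on reduced_reduce)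

lemma group_free_group_on: "group (free_group_on m)"
proof (rule groupI)
  fix x y assume "x \<in> carrier (free_group_on m)" "y \<in> carrier (free_group_on m)"
  then show "x \<otimes>\<^bsub>free_group_on m\<^esub> y \<in> carrier (free_group_on m)"
    unfolding mult_free_group_on by (intro reduce_in_free_group_on) (auto simp: carrier_free_group_on)
next
  show "\<one>\<^bsub>free_group_on m\<^esub> \<in> carrier (free_group_on m)"
    by (simp add: one_free_group_on carrier_free_group_on)
next
  fix x y z
  show "x \<otimes>\<^bsub>free_group_on m\<^esub> y \<otimes>\<^bsub>free_group_on m\<^esub> z = x \<otimes>\<^bsub>free_group_on m\<^esub> (y \<otimes>\<^bsub>free_group_on m\<^esub> z)"
    by (simp add: mult_free_group_on reduce_append_reduce_left reduce_append_reduce_right)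
next
  fix x assume "x \<in> carrier (free_group_on m)"
  then show "\<one>\<^bsub>free_group_on m\<^esub> \<otimes>\<^bsub>free_group_on m\<^esub> x = x"
    by (simp add: one_free_group_on mult_free_group_on carrier_free_group_on reduce_reduced)
next
  fix x assume x: "x \<in> carrier (free_group_on m)"
  let ?y = "reduce (rev (map letter_inv x))"
  have "?y \<in> carrier (free_group_on m)"
    using x by (intro reduce_in_free_group_on) (auto simp: carrier_free_group_on)
  moreover have "?y \<otimes>\<^bsub>free_group_on m\<^esub> x = \<one>\<^bsub>free_group_on m\<^esub>"
    by (simp add: mult_free_group_on one_free_group_on reduce_append_reduce_left reduce_inverse)
  ultimately show "\<exists>y\<in>carrier (free_group_on m). y \<otimes>\<^bsub>free_group_on m\<^esub> x = \<one>\<^bsub>free_group_on m\<^esub>" by blast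
qed

lemma free_group_on_generated:
  "carrier (free_group_on m) \<subseteq> generate (free_group_on m) (ceval m ` Gen ` {1..m})"
proof
  let ?F = "free_group_on m" and ?S = "ceval m ` Gen ` {1..m}"
  interpret F: group ?F by (rule group_free_group_on)
  have letter: "[x] \<in> generate ?F ?S" if x: "fst x \<in> {1..m}" for x
  proof (cases x)
    case (Pair i b)
    have i: "[(i, False)] \<in> ?S" using x Pair by (auto simp: image_image)
    show ?thesis
    proof (cases b)
      case True
      have "[(i, True)] = inv\<^bsub>?F\<^esub> [(i, False)]"
        using x Pair by (intro F.inv_equality[symmetric])
          (auto simp: mult_free_group_on one_free_group_on carrier_free_group_on reduce_def)
      then show ?thesis using Pair True generate.inv[OF i] by simp
    next
      case False
      then show ?thesis using Pair generate.incl[OF i] by simp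
    qed
  qed
  fix w assume "w \<in> carrier ?F"
  then show "w \<in> generate ?F ?S"
  proof (induction w)
    case Nil
    show ?case using generate.one[of ?F] by (simp add: one_free_group_on)
  next
    case (Cons x w)
    then have "w \<in> generate ?F ?S"
      by (auto simp: carrier_free_group_on dest: reduced_ConsD)
    moreover have "[x] \<in> generate ?F ?S"
      using Cons.prems by (intro letter) (simp add: carrier_free_group_on)
    ultimately have "[x] \<otimes>\<^bsub>?F\<^esub> w \<in> generate ?F ?S" by (intro generate.eng)
    moreover have "[x] \<otimes>\<^bsub>?F\<^esub> w = x # w"
      using Cons.prems by (simp add: mult_free_group_on carrier_free_group_on reduce_reduced)
    ultimately show ?case by simp
  qed
qed

lemma basic_commutators_free_group_on:
  "admissible_order r \<Longrightarrow> basic_commutators (free_group_on m) m r (ceval m)"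
  unfolding basic_commutators_def basic_commutators_axioms_def
  using group_free_group_on free_group_on_generated
  by (auto simp: carrier_free_group_on)

section \<open>The degree filtration of the free ring\<close>

definition deg_ge :: "nat \<Rightarrow> pol set" where
  "deg_ge k = {p. \<forall>w\<in>Poly_Mapping.keys p. k \<le> length (letters w)}"

lemma deg_ge_zero [simp]: "0 \<in> deg_ge k"
  by (simp add: deg_ge_def)

lemma deg_ge_0 [simp]: "p \<in> deg_ge 0"
  by (simp add: deg_ge_def)

lemma deg_ge_add: "p \<in> deg_ge k \<Longrightarrow> q \<in> deg_ge k \<Longrightarrow> p + q \<in> deg_ge k"
  unfolding deg_ge_def using keys_add[of p q] by blast

lemma deg_ge_uminus: "p \<in> deg_ge k \<Longrightarrow> - p \<in> deg_ge k"
  by (simp add: deg_ge_def)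

lemma deg_ge_diff: "p \<in> deg_ge k \<Longrightarrow> q \<in> deg_ge k \<Longrightarrow> p - q \<in> deg_ge k"
  using deg_ge_add[of p k "- q"] deg_ge_uminus by simp

lemma deg_ge_sum: "(\<And>i. i \<in> A \<Longrightarrow> f i \<in> deg_ge k) \<Longrightarrow> sum f A \<in> deg_ge k"
  by (induction A rule: infinite_finite_induct) (auto intro: deg_ge_add)

lemma deg_ge_mono: "p \<in> deg_ge k \<Longrightarrow> j \<le> k \<Longrightarrow> p \<in> deg_ge j"
  unfolding deg_ge_def by force

lemma deg_ge_mult:
  assumes "p \<in> deg_ge j" "q \<in> deg_ge k" shows "p * q \<in> deg_ge (j + k)"
proof -
  have "j + k \<le> length (letters w)" if w: "w \<in> Poly_Mapping.keys (p * q)" for w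
  proof -
    obtain u v where "w = u + v" "u \<in> Poly_Mapping.keys p" "v \<in> Poly_Mapping.keys q"
      using w keys_mult[of p q] by blast
    then show ?thesis using assms by (auto simp: deg_ge_def plus_fword_def intro!: add_mono)
  qed
  then show ?thesis by (simp add: deg_ge_def)
qed

lemma deg_ge_mult_left: "q \<in> deg_ge k \<Longrightarrow> p * q \<in> deg_ge k"
  using deg_ge_mult[of p 0 q k] by simp

lemma deg_ge_mult_right: "p \<in> deg_ge k \<Longrightarrow> p * q \<in> deg_ge k"
  using deg_ge_mult[of p k q 0] by simp

lemma deg_ge_bracket:
  "p \<in> deg_ge j \<Longrightarrow> q \<in> deg_ge k \<Longrightarrow> bracket p q \<in> deg_ge (j + k)"
  using deg_ge_mult[of p j q k] deg_ge_mult[of q k p j]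
  by (auto simp: bracket_def add.commute intro: deg_ge_diff)

lemma bracket_diff_left: "bracket (p - q) s = bracket p s - bracket q s"
  by (simp add: bracket_def algebra_simps)

lemma bracket_diff_right: "bracket s (p - q) = bracket s p - bracket s q"
  by (simp add: bracket_def algebra_simps)

lemma deg_ge_var [simp]: "var x \<in> deg_ge 1"
  by (simp add: deg_ge_def mon_def)

lemma deg_ge_power: "p \<in> deg_ge 1 \<Longrightarrow> p ^ k \<in> deg_ge k"
proof (induction k)
  case (Suc k)
  then show ?case using deg_ge_mult[of p 1 "p ^ k" k] by simp
qed simp

text \<open>The Magnus expansion truncated at degree \<open>d\<close>: it is multiplicative only modulo
  \<open>deg_ge d\<close>, which keeps all series finite.\<close>

fun magnus_letter :: "nat \<Rightarrow> letter \<Rightarrow> pol" where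
  "magnus_letter d (i, b) = (if b then (\<Sum>k<d. (- var (Gen i)) ^ k) else 1 + var (Gen i))"

definition magnus :: "nat \<Rightarrow> letter list \<Rightarrow> pol" where
  "magnus d w = prod_list (map (magnus_letter d) w)"

lemma magnus_Nil [simp]: "magnus d [] = 1"
  by (simp add: magnus_def)

lemma magnus_Cons [simp]: "magnus d (x # w) = magnus_letter d x * magnus d w"
  by (simp add: magnus_def)

lemma magnus_append: "magnus d (u @ v) = magnus d u * magnus d v"
  by (simp add: magnus_def)

lemma geometric_left: "(1 - x) * (\<Sum>k<d. x ^ k) = 1 - (x :: 'a :: ring_1) ^ d"
proof (induction d)
  case (Suc d)
  have "(1 - x) * (\<Sum>k<Suc d. x ^ k) = (1 - x) * (\<Sum>k<d. x ^ k) + (x ^ d - x * x ^ d)"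
    by (simp add: algebra_simps)
  then show ?case using Suc by simp
qed simp

lemma geometric_right: "(\<Sum>k<d. x ^ k) * (1 - x) = 1 - (x :: 'a :: ring_1) ^ d"
proof (induction d)
  case (Suc d)
  have "(\<Sum>k<Suc d. x ^ k) * (1 - x) = (\<Sum>k<d. x ^ k) * (1 - x) + (x ^ d - x ^ d * x)"
    by (simp add: algebra_simps)
  then show ?case using Suc by (simp add: power_commutes)
qed simp

lemma magnus_letter_inv: "magnus_letter d x * magnus_letter d (letter_inv x) - 1 \<in> deg_ge d"
proof (cases x)
  case (Pair i b)
  have "(- var (Gen i)) ^ d \<in> deg_ge d" by (intro deg_ge_power deg_ge_uminus deg_ge_var)
  then show ?thesis
    using Pair geometric_left[of "- var (Gen i)" d] geometric_right[of "- var (Gen i)" d]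
    by (auto intro: deg_ge_uminus)
qed

lemma magnus_red_cons: "magnus d (red_cons x w) - magnus_letter d x * magnus d w \<in> deg_ge d"
proof (cases w)
  case (Cons y v)
  have "magnus d v - magnus_letter d x * (magnus_letter d (letter_inv x) * magnus d v) =
      - ((magnus_letter d x * magnus_letter d (letter_inv x) - 1) * magnus d v)"
    by (simp add: algebra_simps)
  also have "\<dots> \<in> deg_ge d" by (intro deg_ge_uminus deg_ge_mult_right magnus_letter_inv)
  finally show ?thesis using Cons by auto
qed auto

lemma magnus_reduce: "magnus d (reduce w) - magnus d w \<in> deg_ge d"
proof (induction w)
  case (Cons x w)
  let ?v = "reduce w"
  have "magnus d (reduce (x # w)) - magnus d (x # w) =
      (magnus d (red_cons x ?v) - magnus_letter d x * magnus d ?v)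
      + magnus_letter d x * (magnus d ?v - magnus d w)"
    by (simp add: reduce_def algebra_simps)
  also have "\<dots> \<in> deg_ge d" by (intro deg_ge_add magnus_red_cons deg_ge_mult_left Cons)
  finally show ?case .
qed (simp add: reduce_def)

lemma magnus_mult:
  "magnus d (x \<otimes>\<^bsub>free_group_on m\<^esub> y) - magnus d x * magnus d y \<in> deg_ge d"
  using magnus_reduce[of d "x @ y"] by (simp add: mult_free_group_on magnus_append)

section \<open>Deviation of the Magnus expansion from one\<close>

definition dev :: "nat \<Rightarrow> letter list \<Rightarrow> pol" where
  "dev d g = magnus d g - 1"

lemma dev_mult:
  "dev d (x \<otimes>\<^bsub>free_group_on m\<^esub> y) - (dev d x + dev d y + dev d x * dev d y) \<in> deg_ge d"
proof -
  have "dev d x + dev d y + dev d x * dev d y = magnus d x * magnus d y - 1"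
    by (simp add: dev_def algebra_simps)
  then show ?thesis using magnus_mult[of d m x y] by (simp add: dev_def)
qed

lemma dev_one: "dev d \<one>\<^bsub>free_group_on m\<^esub> = 0"
  by (simp add: dev_def one_free_group_on)

lemma dev_inv:
  assumes x: "x \<in> carrier (free_group_on m)"
  shows "dev d (inv\<^bsub>free_group_on m\<^esub> x) + dev d x + dev d (inv\<^bsub>free_group_on m\<^esub> x) * dev d x \<in> deg_ge d"
proof -
  interpret group "free_group_on m" by (rule group_free_group_on)
  show ?thesis
    using deg_ge_uminus[OF dev_mult[of d m "inv\<^bsub>free_group_on m\<^esub> x" x]]
    unfolding l_inv[OF x] dev_one diff_0 minus_minus .
qed

lemma dev_mult_mem:
  assumes "dev d x \<in> deg_ge k" "dev d y \<in> deg_ge k" "k \<le> d"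
  shows "dev d (x \<otimes>\<^bsub>free_group_on m\<^esub> y) \<in> deg_ge k"
proof -
  have "dev d (x \<otimes>\<^bsub>free_group_on m\<^esub> y) =
    (dev d (x \<otimes>\<^bsub>free_group_on m\<^esub> y) - (dev d x + dev d y + dev d x * dev d y))
    + (dev d x + dev d y + dev d x * dev d y)" by simp
  also have "\<dots> \<in> deg_ge k"
    using assms by (intro deg_ge_add deg_ge_mult_left deg_ge_mono[OF dev_mult])
  finally show ?thesis .
qed

lemma dev_inv_mem:
  assumes "x \<in> carrier (free_group_on m)" "dev d x \<in> deg_ge k" "k \<le> d"
  shows "dev d (inv\<^bsub>free_group_on m\<^esub> x) \<in> deg_ge k"
proof -
  let ?y = "inv\<^bsub>free_group_on m\<^esub> x"
  have "dev d ?y = (dev d ?y + dev d x + dev d ?y * dev d x) - (dev d x + dev d ?y * dev d x)" by simp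
  also have "\<dots> \<in> deg_ge k"
    using assms by (intro deg_ge_add deg_ge_diff deg_ge_mult_left deg_ge_mono[OF dev_inv])
  finally show ?thesis .
qed

lemma subgroup_dev_deg_ge:
  assumes "k \<le> d"
  shows "subgroup {g \<in> carrier (free_group_on m). dev d g \<in> deg_ge k} (free_group_on m)"
proof -
  interpret group "free_group_on m" by (rule group_free_group_on)
  show ?thesis
  proof (rule subgroupI)
    have "\<one>\<^bsub>free_group_on m\<^esub> \<in> {g \<in> carrier (free_group_on m). dev d g \<in> deg_ge k}"
      by (simp add: dev_one)
    then show "{g \<in> carrier (free_group_on m). dev d g \<in> deg_ge k} \<noteq> {}" by blast
  qed (use assms in \<open>auto intro: dev_mult_mem dev_inv_mem\<close>)
qed

text \<open>By \<open>yx[x, y] = xy\<close>, the deviation \<open>t\<close> of the commutator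
  satisfies \<open>t = bracket p q - s * t\<close> modulo degree \<open>d\<close>, where
  \<open>s\<close> is the deviation of \<open>yx\<close>. As \<open>s\<close> has degree at least
  \<open>e\<close>, the correction \<open>s * t\<close> lies \<open>e\<close> degrees higher than
  \<open>t\<close>.\<close>

lemma dev_gcomm:
  assumes xy: "x \<in> carrier (free_group_on m)" "y \<in> carrier (free_group_on m)"
    and p: "dev d x \<in> deg_ge a" and q: "dev d y \<in> deg_ge b"
    and e: "1 \<le> e" "e \<le> a" "e \<le> b" and k: "k \<le> d" "k \<le> a + b + e"
  shows "dev d (gcomm (free_group_on m) x y) - bracket (dev d x) (dev d y) \<in> deg_ge k"
proof -
  interpret group "free_group_on m" by (rule group_free_group_on)
  let ?c = "gcomm (free_group_on m) x y"
  define p q t s where "p = dev d x" and "q = dev d y" and "t = dev d ?c" and "s = q + p + q * p"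
  define d1 where "d1 = dev d (y \<otimes>\<^bsub>free_group_on m\<^esub> x) - s"
  define d2 where "d2 = dev d (y \<otimes>\<^bsub>free_group_on m\<^esub> x \<otimes>\<^bsub>free_group_on m\<^esub> ?c) - ((s + d1) + t + (s + d1) * t)"
  define d3 where "d3 = dev d (x \<otimes>\<^bsub>free_group_on m\<^esub> y) - (p + q + p * q)"
  have d1: "d1 \<in> deg_ge d" unfolding d1_def s_def p_def q_def by (rule dev_mult)
  have d2: "d2 \<in> deg_ge d"
    using dev_mult[of d m "y \<otimes>\<^bsub>free_group_on m\<^esub> x" ?c] by (simp add: d2_def d1_def t_def)
  have d3: "d3 \<in> deg_ge d" unfolding d3_def p_def q_def by (rule dev_mult)
  \<comment> \<open>All truncation errors are collected in \<open>u\<close>.\<close>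
  define u where "u = d3 - d2 - d1 - d1 * t"
  have u: "u \<in> deg_ge d" unfolding u_def by (intro deg_ge_diff deg_ge_mult_right d1 d2 d3)
  have "(s + d1) + t + (s + d1) * t + d2 = p + q + p * q + d3"
    using mult_gcomm[OF xy] by (simp add: d2_def d3_def)
  then have t: "t = bracket p q - s * t + u"
    by (simp add: s_def u_def bracket_def algebra_simps)
  have s: "s \<in> deg_ge e"
    unfolding s_def using assms
    by (auto simp: p_def q_def intro!: deg_ge_add deg_ge_mult_left intro: deg_ge_mono)
  have pq: "bracket p q \<in> deg_ge (a + b)"
    using assms by (intro deg_ge_bracket) (auto simp: p_def q_def)
  \<comment> \<open>The equation bootstraps the degree of \<open>t\<close>: since \<open>e\<close>
    is at least one, each use gains a degree, until that of the bracket or of the truncation is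
    reached.\<close>
  have tj: "t \<in> deg_ge j" if "j \<le> d" "j \<le> a + b" for j
    using that
  proof (induction j)
    case (Suc j)
    have "s * t \<in> deg_ge (e + j)" using Suc s by (intro deg_ge_mult) auto
    then have "bracket p q - s * t + u \<in> deg_ge (Suc j)"
      using Suc.prems e by (intro deg_ge_add deg_ge_diff deg_ge_mono[OF pq] deg_ge_mono[OF u])
        (auto intro: deg_ge_mono)
    then show ?case using t by simp
  qed simp
  have "s * t \<in> deg_ge (e + min d (a + b))" using s tj by (intro deg_ge_mult) auto
  then have "s * t \<in> deg_ge k" by (rule deg_ge_mono) (use k in auto)
  then have "u - s * t \<in> deg_ge k" using u k by (intro deg_ge_diff) (auto intro: deg_ge_mono)
  moreover have "t - bracket p q = u - s * t" using t by (simp add: algebra_simps)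
  ultimately show ?thesis by (simp add: t_def p_def q_def)
qed

lemma dev_word: "1 \<le> d \<Longrightarrow> dev d w \<in> deg_ge 1"
proof (induction w)
  case (Cons x w)
  have "magnus_letter d x - 1 \<in> deg_ge 1"
  proof (cases x)
    case (Pair i b)
    have "(\<Sum>k<d. (- var (Gen i)) ^ k) = 1 + (\<Sum>k\<in>{1..<d}. (- var (Gen i)) ^ k)"
      using Cons.prems sum.atLeast_Suc_lessThan[of 0 d "\<lambda>k. (- var (Gen i)) ^ k"]
      by (simp add: atLeast0LessThan)
    moreover have "(\<Sum>k\<in>{1..<d}. (- var (Gen i)) ^ k) \<in> deg_ge 1"
      by (intro deg_ge_sum deg_ge_mono[OF deg_ge_power] deg_ge_uminus deg_ge_var) auto
    ultimately show ?thesis using Pair deg_ge_var[of "Gen i"] by simp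
  qed
  then have "(magnus_letter d x - 1) * magnus d w + dev d w \<in> deg_ge 1"
    using Cons by (intro deg_ge_add deg_ge_mult_right) auto
  then show ?case by (simp add: dev_def algebra_simps)
qed (simp add: dev_def)

lemma dev_gamma:
  assumes "g \<in> gamma (free_group_on m) k" "k \<le> d"
  shows "dev d g \<in> deg_ge k"
proof -
  interpret group "free_group_on m" by (rule group_free_group_on)
  have "gamma (free_group_on m) k \<subseteq> {g \<in> carrier (free_group_on m). dev d g \<in> deg_ge k}"
    using assms(2)
  proof (induction k)
    case (Suc k)
    show ?case
    proof (cases "k = 0")
      case True
      then show ?thesis using Suc.prems dev_word by auto
    next
      case False
      then have k: "1 \<le> k" by simp
      show ?thesis unfolding gamma_Suc[OF k]
      proof (rule comm_sub_least[OF subgroup_dev_deg_ge[OF Suc.prems]])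
        fix h x assume h: "h \<in> gamma (free_group_on m) k" and x: "x \<in> carrier (free_group_on m)"
        have hd: "h \<in> carrier (free_group_on m)" "dev d h \<in> deg_ge k" using Suc h by auto
        have xd: "dev d x \<in> deg_ge 1" using Suc.prems by (intro dev_word) auto
        have "dev d (gcomm (free_group_on m) h x) - bracket (dev d h) (dev d x) \<in> deg_ge (Suc k)"
          using Suc.prems k by (intro dev_gcomm[OF hd(1) x hd(2) xd, of 1]) auto
        moreover have "bracket (dev d h) (dev d x) \<in> deg_ge (Suc k)"
          using deg_ge_bracket[OF hd(2) xd] by simp
        ultimately show "gcomm (free_group_on m) h x \<in>
            {g \<in> carrier (free_group_on m). dev d g \<in> deg_ge (Suc k)}"
          using deg_ge_add hd(1) x by fastforce
      qed
    qed
  qed auto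
  then show ?thesis using assms by auto
qed

text \<open>With \<open>E = {}\<close> only generator variables occur, so word length counts weight;
  a commutator kept as a variable would have length one.\<close>

lemma lie_pol_homogeneous:
  "w \<in> Poly_Mapping.keys (lie_pol {} b) \<Longrightarrow> length (letters w) = wt b"
proof (induction b arbitrary: w)
  case (Comm b a)
  let ?p = "lie_pol {} b" and ?q = "lie_pol {} a"
  have "w \<in> Poly_Mapping.keys (?p * ?q) \<or> w \<in> Poly_Mapping.keys (?q * ?p)"
    using Comm.prems keys_diff[of "?p * ?q" "?q * ?p"] by (auto simp: bracket_def)
  then obtain u v where "w = u + v \<or> w = v + u" "u \<in> Poly_Mapping.keys ?p" "v \<in> Poly_Mapping.keys ?q"
    using keys_mult[of ?p ?q] keys_mult[of ?q ?p] by blast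
  then show ?case using Comm.IH by (auto simp: plus_fword_def)
qed (auto simp: mon_def)

lemma lie_pol_deg_ge: "lie_pol {} b \<in> deg_ge (wt b)"
  using lie_pol_homogeneous by (auto simp: deg_ge_def)

text \<open>\<open>dev_gcomm\<close> with \<open>e = 1\<close> gives the bracket of the deviations
  up to terms of degree above the total weight; replacing each deviation by its leading term changes
  the bracket only in those degrees.\<close>

lemma dev_ceval:
  assumes "admissible_order r" "basic m r b" "wt b < d"
  shows "dev d (ceval m b) - lie_pol {} b \<in> deg_ge (Suc (wt b))"
proof -
  interpret basic_commutators "free_group_on m" m r "ceval m"
    by (rule basic_commutators_free_group_on[OF assms(1)])
  show ?thesis
    using assms(2,3)
  proof (induction b rule: basic.induct)
    case (gen i)
    then show ?case by (simp add: dev_def)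
  next
    case (comm b a)
    let ?p = "dev d (ceval m b)" and ?q = "dev d (ceval m a)"
    have pq: "?p \<in> deg_ge (wt b)" "?q \<in> deg_ge (wt a)"
      using comm ev_gamma by (auto intro!: dev_gamma)
    have 1: "dev d (ceval m (Comm b a)) - bracket ?p ?q \<in> deg_ge (Suc (wt b + wt a))"
      using comm ev_carrier wt_pos[of a] wt_pos[of b] dev_gcomm[OF _ _ pq, of m 1]
      by (simp add: Suc_leI)
    have 2: "bracket (?p - lie_pol {} b) ?q \<in> deg_ge (Suc (wt b + wt a))"
      using deg_ge_bracket[OF comm.IH(1) pq(2)] comm.prems by simp
    have 3: "bracket (lie_pol {} b) (?q - lie_pol {} a) \<in> deg_ge (Suc (wt b + wt a))"
      using deg_ge_bracket[OF lie_pol_deg_ge comm.IH(2), of b] comm.prems by simp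
    have "dev d (ceval m (Comm b a)) - lie_pol {} (Comm b a) =
       (dev d (ceval m (Comm b a)) - bracket ?p ?q) + bracket (?p - lie_pol {} b) ?q
       + bracket (lie_pol {} b) (?q - lie_pol {} a)"
      by (simp add: bracket_diff_left bracket_diff_right)
    also have "\<dots> \<in> deg_ge (wt (Comm b a) + 1)"
      using 1 2 3 by (simp add: deg_ge_add)
    finally show ?case by simp
  qed
qed

lemma frag_extend_minus_fun: "frag_extend f x - frag_extend g x = frag_extend (\<lambda>a. f a - g a) x"
proof (rule frag_induction[of x UNIV])
  fix a b
  assume "frag_extend f a - frag_extend g a = frag_extend (\<lambda>a. f a - g a) a"
    "frag_extend f b - frag_extend g b = frag_extend (\<lambda>a. f a - g a) b"
  then show "frag_extend f (a - b) - frag_extend g (a - b) = frag_extend (\<lambda>a. f a - g a) (a - b)"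
    by (simp add: frag_extend_diff algebra_simps)
qed auto

lemma frag_extend_deg_ge:
  "(\<And>a. a \<in> Poly_Mapping.keys x \<Longrightarrow> f a \<in> deg_ge k) \<Longrightarrow> frag_extend f x \<in> deg_ge k"
  unfolding frag_extend_def by (intro deg_ge_sum) (auto simp: deg_ge_def)

text \<open>In a nontrivial relation the part \<open>y\<close> of least weight \<open>w\<close>
  alone contributes to degree \<open>w\<close>, which gives a relation between Lie polynomials of
  weight \<open>w\<close>.\<close>

lemma leading_lie_pol_independent:
  assumes r: "admissible_order r"
    and keys: "Poly_Mapping.keys x \<subseteq> {t. basic m r t \<and> wt t < d}"
    and lead: "\<And>t. t \<in> Poly_Mapping.keys x \<Longrightarrow> q t - lie_pol {} t \<in> deg_ge (Suc (wt t))"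
    and rel: "frag_extend q x \<in> deg_ge d"
  shows "x = 0"
proof (rule ccontr)
  assume "x \<noteq> 0"
  then have ne: "Poly_Mapping.keys x \<noteq> {}" by simp
  define w where "w = Min (wt ` Poly_Mapping.keys x)"
  have wmin: "w \<le> wt t" if "t \<in> Poly_Mapping.keys x" for t
    using that by (simp add: w_def)
  obtain t0 where t0: "t0 \<in> Poly_Mapping.keys x" "wt t0 = w"
    using Min_in[of "wt ` Poly_Mapping.keys x"] ne unfolding w_def by fastforce
  have wd: "Suc w \<le> d" using t0 keys by auto
  define y where "y = frag_extend (\<lambda>t. if wt t = w then frag_of t else 0) x"
  have ykeys: "Poly_Mapping.keys y \<subseteq> {b. basic m r b \<and> wt b = w}"
    using keys_frag_extend[of "\<lambda>t. if wt t = w then frag_of t else 0" x] keys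
    by (fastforce simp: y_def split: if_splits)
  have y: "frag_extend (lie_pol {}) y = frag_extend (\<lambda>t. if wt t = w then lie_pol {} t else 0) x"
    unfolding y_def frag_extend_comp by (rule frag_extend_eq) auto
  have "frag_extend q x - frag_extend (lie_pol {}) y \<in> deg_ge (Suc w)"
    unfolding y frag_extend_minus_fun
  proof (rule frag_extend_deg_ge)
    fix t assume t: "t \<in> Poly_Mapping.keys x"
    show "q t - (if wt t = w then lie_pol {} t else 0) \<in> deg_ge (Suc w)"
    proof (cases "wt t = w")
      case True
      then show ?thesis using lead[OF t] by simp
    next
      case False
      then have "Suc w \<le> wt t" using wmin[OF t] by simp
      moreover have "(q t - lie_pol {} t) + lie_pol {} t \<in> deg_ge (wt t)"
        by (intro deg_ge_add lie_pol_deg_ge deg_ge_mono[OF lead[OF t]]) simp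
      ultimately show ?thesis using False by (auto intro: deg_ge_mono)
    qed
  qed
  with deg_ge_mono[OF rel wd] have "frag_extend (lie_pol {}) y \<in> deg_ge (Suc w)"
    using deg_ge_diff by fastforce
  \<comment> \<open>Homogeneous of degree \<open>w\<close>, yet without terms of degree below
    \<open>w + 1\<close>, the combination vanishes.\<close>
  moreover have "length (letters v) = w" if v: "v \<in> Poly_Mapping.keys (frag_extend (lie_pol {}) y)" for v
  proof -
    obtain b where b: "b \<in> Poly_Mapping.keys y" "v \<in> Poly_Mapping.keys (lie_pol {} b)"
      using v keys_frag_extend[of "lie_pol {}" y] by blast
    then show ?thesis using lie_pol_homogeneous[OF b(2)] ykeys by auto
  qed
  ultimately have "Poly_Mapping.keys (frag_extend (lie_pol {}) y) = {}"
    by (fastforce simp: deg_ge_def)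
  then have "y = 0" using lie_pol_independent[OF r ykeys] by simp
  \<comment> \<open>With \<open>y = 0\<close>, removing the terms of weight \<open>w\<close> leaves
    \<open>x\<close> unchanged, against the choice of \<open>t0\<close>.\<close>
  then have "x = frag_extend frag_of x - y" by (simp flip: frag_expansion)
  also have "\<dots> = frag_extend (\<lambda>t. frag_of t - (if wt t = w then frag_of t else 0)) x"
    unfolding y_def frag_extend_minus_fun ..
  finally have "t0 \<in> Poly_Mapping.keys (frag_extend (\<lambda>t. frag_of t - (if wt t = w then frag_of t else 0)) x)"
    using t0(1) by simp
  then obtain t where "t0 \<in> Poly_Mapping.keys (frag_of t - (if wt t = w then frag_of t else 0))"
    using keys_frag_extend[of "\<lambda>t. frag_of t - (if wt t = w then frag_of t else 0)" x] by blast
  then show False using t0(2) by (auto split: if_splits)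
qed

section \<open>The multiplier\<close>

text \<open>As \<open>n \<le> s\<close>, the subgroup \<open>?A\<close> lies in
  \<open>gamma G (s + n)\<close>, so its commutators with \<open>?H\<close> fall into
  \<open>N\<close>. Hence \<open>?H\<close> normalizes \<open>?K\<close>, and membership of a
  commutator in \<open>?K\<close> may be tested on generators of \<open>?H\<close>, first in one
  entry and then in the other.\<close>

lemma (in basic_commutators) comm_sub_gamma_generated:
  assumes s: "1 \<le> s" and n: "n \<le> s"
  defines "Y \<equiv> {y. basic m r y \<and> s \<le> wt y \<and> wt y < s + n}"
  defines "N \<equiv> comm_sub G (gamma G (s + n)) (gamma G s)"
  shows "comm_sub G (gamma G s) (gamma G s) \<subseteq>
    generate G (N \<union> {ev (Comm b a) |b a. b \<in> Y \<and> a \<in> Y \<and> (a, b) \<in> r})" (is "?A \<subseteq> generate G ?S")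
proof -
  let ?K = "generate G ?S" and ?H = "gamma G s"
  have ev_H: "ev y \<in> ?H" if "y \<in> Y" for y
    using that ev_gamma[of y] gamma_antimono[of s "wt y"] by (auto simp: Y_def)
  have A: "subgroup ?A G" by (intro normal_imp_subgroup comm_sub_normal gamma_normal)
  have "N \<subseteq> ?A" unfolding N_def
    using gamma_antimono[of s "s + n"] by (intro comm_sub_least[OF A] gcomm_in_comm_sub) auto
  moreover have "ev (Comm b a) \<in> ?A" if "b \<in> Y" "a \<in> Y" for a b
    unfolding ev_Comm using that ev_H by (intro gcomm_in_comm_sub)
  ultimately have SA: "?S \<subseteq> ?A" by auto
  have KA: "?K \<subseteq> ?A" by (rule generate_subgroup_incl[OF SA A])
  have K: "subgroup ?K G"
    by (rule generate_is_subgroup[OF subset_trans[OF SA subgroup.subset[OF A]]])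
  have NK: "N \<subseteq> ?K" by (auto intro: generate.incl)
  have A2: "?A \<subseteq> gamma G (s + n)"
    using gcomm_gamma[OF s s] gamma_antimono[of "s + n" "s + s"] n
    by (intro comm_sub_least[OF gamma_subgroup]) auto
  have conj: "h \<otimes> k \<otimes> inv h \<in> ?K" if h: "h \<in> ?H" and k: "k \<in> ?K" for h k
  proof -
    have c: "h \<in> carrier G" "k \<in> carrier G"
      using h k gamma_carrier subgroup.mem_carrier[OF K] by auto
    have "gcomm G k (inv h) \<in> N"
      unfolding N_def using h k KA A2 subgroup.m_inv_closed[OF gamma_subgroup h]
      by (intro gcomm_in_comm_sub) auto
    then have "k \<otimes> gcomm G k (inv h) \<in> ?K" using NK k subgroup.m_closed[OF K] by auto
    then show ?thesis using c by (simp add: word_simps)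
  qed
  have T: "subgroup {t \<in> ?H. gcomm G t z \<in> ?K} G" if "z \<in> ?H" for z
    by (rule subgroup_gcomm_left_in[OF K gamma_subgroup that conj])
  have gen: "gcomm G g z \<in> ?K"
    if g: "g \<in> ?H" and z: "z \<in> ?H" and ys: "\<And>y. y \<in> Y \<Longrightarrow> gcomm G (ev y) z \<in> ?K" for g z
  proof -
    have "ev ` Y \<union> gamma G (s + n) \<subseteq> {t \<in> ?H. gcomm G t z \<in> ?K}"
    proof
      fix t assume "t \<in> ev ` Y \<union> gamma G (s + n)"
      then show "t \<in> {t \<in> ?H. gcomm G t z \<in> ?K}"
      proof
        assume t: "t \<in> gamma G (s + n)"
        then have "gcomm G t z \<in> N" unfolding N_def using z by (rule gcomm_in_comm_sub)
        then show ?thesis using t NK gamma_antimono[of s "s + n"] by auto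
      qed (use ys ev_H in auto)
    qed
    from generate_subgroup_incl[OF this T[OF z]] show ?thesis
      using gamma_subset_generate_basics[OF s, of "s + n"] g unfolding Y_def by auto
  qed
  have YY: "gcomm G (ev y) (ev y') \<in> ?K" if y: "y \<in> Y" "y' \<in> Y" for y y'
  proof -
    have c: "ev y \<in> carrier G" "ev y' \<in> carrier G" using ev_H y gamma_carrier by blast+
    consider "y = y'" | "(y', y) \<in> r" | "(y, y') \<in> r" using admissible_total[OF order] by blast
    then show ?thesis
    proof cases
      case 1
      then have "gcomm G (ev y) (ev y') = \<one>" using gcomm_self[OF c(1)] by simp
      then show ?thesis using generate.one[of G ?S] by simp
    next
      case 2
      then have "ev (Comm y y') \<in> ?K" using y by (intro generate.incl) auto
      then show ?thesis by (simp add: ev_Comm)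
    next
      case 3
      then have "ev (Comm y' y) \<in> ?K" using y by (intro generate.incl) auto
      then show ?thesis using gcomm_swap_mem[OF K c(2,1)] by (simp add: ev_Comm)
    qed
  qed
  have "gcomm G g h \<in> ?K" if g: "g \<in> ?H" and h: "h \<in> ?H" for g h
  proof (rule gen[OF g h])
    fix y assume y: "y \<in> Y"
    have "gcomm G h (ev y) \<in> ?K" by (rule gen[OF h ev_H[OF y] YY[OF _ y]])
    then show "gcomm G (ev y) h \<in> ?K"
      using gcomm_swap_mem[OF K] ev_H[OF y] h gamma_carrier by blast
  qed
  then show ?thesis by (rule comm_sub_least[OF K])
qed

section \<open>Additivity of deviations on deep subgroups\<close>

lemma dev_mult_inv:
  assumes "y \<in> carrier (free_group_on m)" "dev d x \<in> deg_ge k" "dev d y \<in> deg_ge k" "e \<le> d" "e \<le> 2 * k" "k \<le> d"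
  shows "dev d (x \<otimes>\<^bsub>free_group_on m\<^esub> inv\<^bsub>free_group_on m\<^esub> y) - (dev d x - dev d y) \<in> deg_ge e"
proof -
  let ?z = "inv\<^bsub>free_group_on m\<^esub> y"
  have z: "dev d ?z \<in> deg_ge k" by (rule dev_inv_mem) fact+
  have e: "p \<in> deg_ge (k + k) \<Longrightarrow> p \<in> deg_ge e" for p using deg_ge_mono assms(5) by (simp add: mult_2)
  have "dev d (x \<otimes>\<^bsub>free_group_on m\<^esub> ?z) - (dev d x - dev d y) =
    (dev d (x \<otimes>\<^bsub>free_group_on m\<^esub> ?z) - (dev d x + dev d ?z + dev d x * dev d ?z))
    + (dev d ?z + dev d y + dev d ?z * dev d y) + dev d x * dev d ?z - dev d ?z * dev d y"
    by simp
  also have "\<dots> \<in> deg_ge e"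
    using assms z
    by (intro deg_ge_add deg_ge_diff e[OF deg_ge_mult] deg_ge_mono[OF dev_mult] deg_ge_mono[OF dev_inv])
  finally show ?thesis .
qed

text \<open>For deviations of degree at least \<open>k\<close> the product terms have degree
  \<open>2 * k \<ge> e\<close>, so \<open>dev\<close> is additive modulo \<open>deg_ge e\<close>.
  Membership in an additive subgroup \<open>V\<close> containing that ideal can then be tested on
  generators.\<close>

lemma dev_generate_mem:
  assumes V: "0 \<in> V" "\<And>p q. p \<in> V \<Longrightarrow> q \<in> V \<Longrightarrow> p - q \<in> V" "deg_ge e \<subseteq> V"
    and e: "e \<le> d" "e \<le> 2 * k" "k \<le> d"
    and S: "\<And>x. x \<in> S \<Longrightarrow> x \<in> carrier (free_group_on m) \<and> dev d x \<in> deg_ge k \<and> dev d x \<in> V"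
    and g: "g \<in> generate (free_group_on m) S"
  shows "dev d g \<in> V"
proof -
  interpret group "free_group_on m" by (rule group_free_group_on)
  let ?F = "free_group_on m"
  let ?T = "{g \<in> carrier ?F. dev d g \<in> deg_ge k \<and> dev d g \<in> V}"
  have quot: "x \<otimes>\<^bsub>?F\<^esub> inv\<^bsub>?F\<^esub> y \<in> ?T" if x: "x \<in> ?T" and y: "y \<in> ?T" for x y
  proof -
    have "dev d (x \<otimes>\<^bsub>?F\<^esub> inv\<^bsub>?F\<^esub> y) - (dev d x - dev d y) \<in> V"
      using V(3) dev_mult_inv[of y m d x k e] x y e by auto
    then have "(dev d (x \<otimes>\<^bsub>?F\<^esub> inv\<^bsub>?F\<^esub> y) - (dev d x - dev d y)) - (0 - (dev d x - dev d y)) \<in> V"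
      using V x y by blast
    moreover have "dev d (x \<otimes>\<^bsub>?F\<^esub> inv\<^bsub>?F\<^esub> y) \<in> deg_ge k"
      using x y e by (auto intro!: dev_mult_mem dev_inv_mem)
    ultimately show ?thesis using x y by simp
  qed
  have one: "\<one>\<^bsub>?F\<^esub> \<in> ?T" using V by (simp add: dev_one)
  have inv: "inv\<^bsub>?F\<^esub> y \<in> ?T" if y: "y \<in> ?T" for y
    using quot[OF one y] y by simp
  have "subgroup ?T ?F"
  proof (rule subgroupI)
    fix x y assume "x \<in> ?T" "y \<in> ?T"
    then show "x \<otimes>\<^bsub>?F\<^esub> y \<in> ?T" using quot[of x "inv\<^bsub>?F\<^esub> y"] inv[of y] by auto
  qed (use one inv in auto)
  from generate_subgroup_incl[OF _ this, of S] show ?thesis using S g by auto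
qed

text \<open>If \<open>u = [b1, b2]\<close>, then \<open>b2 < b1\<close> in the order gives
  \<open>2 * wt b2 \<le> wt u < 2 * wt v\<close>, so \<open>b2\<close> precedes \<open>v\<close> by
  weight alone.\<close>

lemma basic_Comm_low_wt:
  assumes r: "admissible_order r" and uv: "basic m r u" "basic m r v" "(v, u) \<in> r"
    and wt: "wt u < 2 * wt v"
  shows "basic m r (Comm u v)"
proof (rule basic.comm[OF uv], intro allI impI disjI2)
  fix b1 b2 assume u: "u = Comm b1 b2"
  then have "(b2, b1) \<in> r" using uv(1) by (auto elim: basic_CommE)
  then have "wt b2 \<le> wt b1" by (rule admissible_wt_le[OF r])
  then show "(b2, v) \<in> r" using u wt by (intro admissible_wt[OF r]) auto
qed

text \<open>Both entries of a bracket expand into deviations of basic commutators up to degree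
  \<open>2 * s\<close>, and bracketing with an element of degree \<open>s\<close> pushes that error
  to degree \<open>3 * s \<ge> d\<close>. Brackets of total weight at least \<open>d\<close> vanish
  modulo degree \<open>d\<close>; the others come from basic commutators.\<close>

lemma dev_comm_sub_gamma_span:
  fixes m r s n
  assumes r: "admissible_order r" and s: "1 \<le> s" "1 \<le> n" "2 * n \<le> s"
    and d: "d = 2 * s + 2 * n - 1"
    and g: "g \<in> comm_sub (free_group_on m) (gamma (free_group_on m) (s + n)) (gamma (free_group_on m) s)"
  obtains y where
    "Poly_Mapping.keys y \<subseteq> {Comm u v |u v. basic m r (Comm u v) \<and> s + n \<le> wt u \<and> wt u + wt v < d}"
    "dev d g - frag_extend (\<lambda>t. dev d (ceval m t)) y \<in> deg_ge d"
proof -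
  let ?F = "free_group_on m"
  interpret basic_commutators ?F m r "ceval m" by (rule basic_commutators_free_group_on[OF r])
  define W where "W = {Comm u v |u v. basic m r (Comm u v) \<and> s + n \<le> wt u \<and> wt u + wt v < d}"
  define q where "q t = dev d (ceval m t)" for t
  define V where "V = {p. \<exists>y. Poly_Mapping.keys y \<subseteq> W \<and> p - frag_extend q y \<in> deg_ge d}"
  \<comment> \<open>The bound \<open>3 * s\<close> makes the deviation of a commutator of elements
    of \<open>gamma ?F s\<close> a bracket modulo degree \<open>d\<close>; the bound
    \<open>2 * (2 * s)\<close> makes deviations additive on products of such commutators.\<close>
  have ds: "2 * s \<le> d" "d \<le> 3 * s" "d \<le> 2 * (2 * s)" "s \<le> d" using s d by auto
  have V_ideal: "deg_ge d \<subseteq> V"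
    unfolding V_def by (auto intro!: exI[of _ 0])
  then have V_zero: "0 \<in> V" by auto
  have V_diff: "p - p' \<in> V" if pV: "p \<in> V" "p' \<in> V" for p p'
  proof -
    obtain y y' where y: "Poly_Mapping.keys y \<subseteq> W" "p - frag_extend q y \<in> deg_ge d"
      "Poly_Mapping.keys y' \<subseteq> W" "p' - frag_extend q y' \<in> deg_ge d"
      using pV unfolding V_def by blast
    have "p - p' - frag_extend q (y - y') = (p - frag_extend q y) - (p' - frag_extend q y')"
      by (simp add: frag_extend_diff)
    moreover have "\<dots> \<in> deg_ge d" by (rule deg_ge_diff[OF y(2,4)])
    ultimately have "p - p' - frag_extend q (y - y') \<in> deg_ge d" by (rule ssubst)
    moreover have "Poly_Mapping.keys (y - y') \<subseteq> W" using y keys_diff[of y y'] by blast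
    ultimately show ?thesis unfolding V_def by blast
  qed
  have V_cong: "p \<in> V" if "p - p' \<in> deg_ge d" "p' \<in> V" for p p'
    using V_diff[of "p - p'" "0 - p'"] V_diff[OF V_zero that(2)] that V_ideal by auto
  have gamma_s: "dev d x \<in> deg_ge s" if "x \<in> gamma ?F s" for x
    using that ds by (intro dev_gamma) auto
  have comm: "dev d (gcomm ?F x y) - bracket (dev d x) (dev d y) \<in> deg_ge d"
    if "x \<in> gamma ?F s" "y \<in> gamma ?F s" for x y
    using that ds s by (intro dev_gcomm[where a = s and b = s and e = s]) (auto intro: gamma_carrier gamma_s)
  have ev_s: "ceval m b \<in> gamma ?F s" if "basic m r b" "s \<le> wt b" for b
    using ev_gamma[OF that(1)] gamma_antimono[OF that(2)] by auto
  have basics: "bracket (q u) (q v) \<in> V"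
    if u: "basic m r u" "s + n \<le> wt u" and v: "basic m r v" "s \<le> wt v" for u v
  proof (cases "wt u + wt v < d")
    case True
    \<comment> \<open>Total weight below \<open>2 * s + 2 * n - 1\<close> and
      \<open>wt u \<ge> s + n\<close> leave \<open>wt v \<le> s + n - 2\<close>.\<close>
    have vu: "(v, u) \<in> r" using True u v d by (intro admissible_wt[OF r]) auto
    have "basic m r (Comm u v)"
      using True u v s d vu by (intro basic_Comm_low_wt[OF r]) auto
    then have "Comm u v \<in> W" using True u by (auto simp: W_def)
    then have "q (Comm u v) \<in> V"
      unfolding V_def by (auto intro!: exI[of _ "frag_of (Comm u v)"])
    moreover have "bracket (q u) (q v) - q (Comm u v) \<in> deg_ge d"
      using deg_ge_uminus[OF comm[of "ceval m u" "ceval m v"]] ev_s u v by (simp add: q_def)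
    ultimately show ?thesis using V_cong by blast
  next
    case False
    have "q b \<in> deg_ge (min d (wt b))" if "basic m r b" for b
      unfolding q_def using ev_gamma[OF that] gamma_antimono[of "min d (wt b)" "wt b"]
      by (intro dev_gamma[of _ m]) auto
    from this[OF u(1)] this[OF v(1)] have "bracket (q u) (q v) \<in> deg_ge (min d (wt u) + min d (wt v))"
      by (rule deg_ge_bracket)
    then have "bracket (q u) (q v) \<in> deg_ge d" by (rule deg_ge_mono) (use False in auto)
    then show ?thesis using V_ideal by auto
  qed
  have brackets: "bracket (dev d h) (dev d k) \<in> V"
    if h: "h \<in> gamma ?F (s + n)" and k: "k \<in> gamma ?F s" for h k
  proof -
    \<comment> \<open>Reduction of one argument to basic commutators, applied first on the left and
      then on the right of the bracket. There \<open>U\<close> consists of the elements whose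
      bracket with the fixed other argument lies in \<open>V\<close>.\<close>
    have dev_in: "dev d x \<in> U"
      if U: "0 \<in> U" "\<And>p p'. p \<in> U \<Longrightarrow> p' \<in> U \<Longrightarrow> p - p' \<in> U" "deg_ge (2 * s) \<subseteq> U"
        and j: "s \<le> j" "j \<le> 2 * s" and x: "x \<in> gamma ?F j"
        and bU: "\<And>b. basic m r b \<Longrightarrow> j \<le> wt b \<Longrightarrow> q b \<in> U" for U j x
    proof (rule dev_generate_mem[OF U, of d s])
      show "x \<in> generate ?F (ceval m ` {b. basic m r b \<and> j \<le> wt b \<and> wt b < 2 * s} \<union> gamma ?F (2 * s))"
        using gamma_subset_generate_basics[of j "2 * s"] j s x by auto
      fix z assume "z \<in> ceval m ` {b. basic m r b \<and> j \<le> wt b \<and> wt b < 2 * s} \<union> gamma ?F (2 * s)"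
      then show "z \<in> carrier ?F \<and> dev d z \<in> deg_ge s \<and> dev d z \<in> U"
      proof
        assume z: "z \<in> gamma ?F (2 * s)"
        then have "dev d z \<in> deg_ge (2 * s)" using ds by (intro dev_gamma) auto
        then show ?thesis using U z deg_ge_mono[of _ "2 * s" s] gamma_carrier by auto
      next
        assume "z \<in> ceval m ` {b. basic m r b \<and> j \<le> wt b \<and> wt b < 2 * s}"
        then show ?thesis using bU j ev_s gamma_s ev_carrier by (auto simp: q_def)
      qed
    qed (use ds in auto)
    have br: "bracket p p' \<in> V" if "p \<in> deg_ge s \<and> p' \<in> deg_ge (2 * s) \<or> p \<in> deg_ge (2 * s) \<and> p' \<in> deg_ge s" for p p'
      using that deg_ge_bracket[of p s p' "2 * s"] deg_ge_bracket[of p "2 * s" p' s] ds V_ideal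
        deg_ge_mono[of "bracket p p'" "3 * s" d] by auto
    have zero: "bracket p 0 = 0" "bracket 0 p = 0" for p by (auto simp: bracket_def)
    have hv: "bracket (dev d h) (q v) \<in> V" if v: "basic m r v" "s \<le> wt v" for v
    proof -
      have qv: "q v \<in> deg_ge s" unfolding q_def by (rule gamma_s[OF ev_s[OF v]])
      have "dev d h \<in> {p. bracket p (q v) \<in> V}"
        by (rule dev_in[OF _ _ _ _ _ h])
           (use basics v s br qv in \<open>auto simp: zero V_zero bracket_diff_left V_diff\<close>)
      then show ?thesis by simp
    qed
    have hs: "dev d h \<in> deg_ge s" using h gamma_antimono[of s "s + n"] gamma_s by auto
    have "dev d k \<in> {p. bracket (dev d h) p \<in> V}"
      by (rule dev_in[OF _ _ _ _ _ k])
         (use hv hs s br in \<open>auto simp: zero V_zero bracket_diff_right V_diff\<close>)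
    then show ?thesis by simp
  qed
  have "dev d g \<in> V"
  proof (rule dev_generate_mem[OF V_zero V_diff V_ideal, where k = "2 * s"])
    show "g \<in> generate ?F {gcomm ?F h k |h k. h \<in> gamma ?F (s + n) \<and> k \<in> gamma ?F s}"
      using g by (simp add: comm_sub_def)
    fix x assume "x \<in> {gcomm ?F h k |h k. h \<in> gamma ?F (s + n) \<and> k \<in> gamma ?F s}"
    then obtain h k where x: "x = gcomm ?F h k" and h: "h \<in> gamma ?F (s + n)" and k: "k \<in> gamma ?F s"
      by auto
    have h': "h \<in> gamma ?F s" using h gamma_antimono[of s "s + n"] by auto
    have "x \<in> gamma ?F (s + s)" unfolding x by (rule gcomm_gamma[OF s(1) s(1) h' k])
    then have "dev d x \<in> deg_ge (2 * s)" "x \<in> carrier ?F"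
      using ds gamma_carrier by (auto simp: mult_2 intro: dev_gamma)
    moreover have "dev d x \<in> V"
      unfolding x by (rule V_cong[OF comm[OF h' k] brackets[OF h k]])
    ultimately show "x \<in> carrier ?F \<and> dev d x \<in> deg_ge (2 * s) \<and> dev d x \<in> V" by simp
  qed (use ds in auto)
  then show thesis using that unfolding V_def W_def q_def by blast
qed

lemma (in group) iter_comm_gamma: "1 \<le> k \<Longrightarrow> iter_comm G (gamma G k) c = gamma G (k + c)"
  by (induction c) (simp_all add: gamma_Suc)

lemma (in group) r_coset_eq_mem:
  assumes "N \<lhd> G" "x \<in> carrier G" "y \<in> carrier G" "N #> x = N #> y"
  shows "x \<otimes> inv y \<in> N"
proof -
  interpret N: normal N G by fact
  have "x \<in> N #> y" using rcos_self[OF assms(2) N.subgroup_axioms] assms(4) by simp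
  then obtain h where "h \<in> N" "x = h \<otimes> y" by (auto simp: r_coset_def)
  then show ?thesis using assms(3) by (simp add: m_assoc)
qed

theorem theorem2p6:
  fixes m n c :: nat and r :: "(cterm \<times> cterm) set"
  assumes "m \<ge> 1" and "n \<ge> 1" and "c \<ge> 1" and "c > 2 * n - 2"
    and "admissible_order r"
  defines "F \<equiv> free_group_on m"
  defines "Y \<equiv> {y. basic m r y \<and> c + 1 \<le> wt y \<and> wt y \<le> c + n}"
  defines "Z \<equiv> {Comm b a | b a. b \<in> Y \<and> a \<in> Y \<and> (a, b) \<in> r}"
  defines "A \<equiv> comm_sub F (gamma F (c + 1)) (gamma F (c + 1))"
  defines "N \<equiv> comm_sub F (gamma F (c + n + 1)) (gamma F (c + 1))"
  defines "Q \<equiv> (F\<lparr>carrier := A\<rparr>) Mod N"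
  shows "nc1_multiplier F (gamma F (n + 1)) c = Q
    \<and> inj_on (\<lambda>z. N #>\<^bsub>F\<^esub> ceval m z) Z
    \<and> free_abelian_basis Q ((\<lambda>z. N #>\<^bsub>F\<^esub> ceval m z) ` Z)"
proof -
  note r = assms(5)
  define s where "s = c + 1"
  have sn: "1 \<le> s" "2 * n \<le> s" "n \<le> s" "1 \<le> n" using assms(2-4) by (auto simp: s_def)
  \<comment> \<open>Elements of \<open>Z\<close> have weight at most
    \<open>2 * (s + n - 1) = d - 1\<close>, so truncation at degree \<open>d\<close> keeps all their
    leading terms, while \<open>2 * n \<le> s\<close> keeps \<open>d\<close> below
    \<open>3 * s\<close>.\<close>
  define d where "d = 2 * s + 2 * n - 1"
  have ds: "2 * s \<le> d" "d \<le> 2 * (2 * s)" using sn by (auto simp: d_def)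
  interpret F: basic_commutators F m r "ceval m"
    unfolding F_def by (rule basic_commutators_free_group_on[OF r])
  have A_eq: "A = comm_sub F (gamma F s) (gamma F s)" and N_eq: "N = comm_sub F (gamma F (s + n)) (gamma F s)"
    by (simp_all add: A_def N_def s_def add_ac)
  have Y_eq: "Y = {y. basic m r y \<and> s \<le> wt y \<and> wt y < s + n}"
    by (auto simp: Y_def s_def)
  have A: "A \<lhd> F" "subgroup A F" and N: "N \<lhd> F" "subgroup N F"
    unfolding A_eq N_eq by (intro normal_imp_subgroup F.comm_sub_normal F.gamma_normal)+
  have NA: "N \<subseteq> A"
    unfolding N_eq A_eq using F.gamma_antimono[of s "s + n"]
    by (intro F.comm_sub_least[OF A(2)[unfolded A_eq]] F.gcomm_in_comm_sub) auto
  have A2s: "A \<subseteq> gamma F (2 * s)"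
    unfolding A_eq using F.gcomm_gamma[OF sn(1) sn(1)]
    by (intro F.comm_sub_least[OF F.gamma_subgroup]) (auto simp: mult_2)
  have A_carrier: "a \<in> A \<Longrightarrow> a \<in> carrier F" for a using subgroup.mem_carrier[OF A(2)] .
  have A_dev: "dev d a \<in> deg_ge (2 * s)" if "a \<in> A" for a
    using that A2s ds by (intro dev_gamma[of _ m]) (auto simp: F_def)

  have multiplier: "nc1_multiplier F (gamma F (n + 1)) c = Q"
  proof -
    \<comment> \<open>Since \<open>2 * s \<ge> n + 1\<close>, intersecting \<open>A\<close> with the
      relation subgroup changes nothing.\<close>
    have "A \<subseteq> gamma F (n + 1)"
      using A2s F.gamma_antimono[of "n + 1" "2 * s"] sn by auto
    then have "gamma F (n + 1) \<inter> A = A" by blast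
    moreover have "iter_comm F (gamma F (n + 1)) c = gamma F (c + n + 1)"
      using F.iter_comm_gamma[of "n + 1" c] by (simp add: add_ac)
    ultimately show ?thesis by (simp add: nc1_multiplier_def Q_def A_def N_def)
  qed

  define p where "p = (\<lambda>a. N #>\<^bsub>F\<^esub> a)"
  define q where "q = (\<lambda>t. dev d (ceval m t))"
  let ?FA = "F\<lparr>carrier := A\<rparr>"
  have NFA: "N \<lhd> ?FA" by (rule F.normal_restrict_supergroup[OF A(2) N(1) NA])
  interpret FA: group ?FA by (rule F.subgroup_imp_group[OF A(2)])
  interpret NFA: normal N ?FA by (rule NFA)
  interpret Q: group Q unfolding Q_def by (rule NFA.factorgroup_is_group)
  have p_FA: "p = (\<lambda>a. N #>\<^bsub>?FA\<^esub> a)" by (simp add: p_def r_coset_def)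
  have p_hom: "p \<in> hom ?FA Q" unfolding p_FA Q_def by (rule NFA.r_coset_hom_Mod)
  have p_mult: "p (a \<otimes>\<^bsub>F\<^esub> b) = p a \<otimes>\<^bsub>Q\<^esub> p b" if "a \<in> A" "b \<in> A" for a b
    using hom_mult[OF p_hom, of a b] that by simp
  have p_closed: "p a \<in> carrier Q" if "a \<in> A" for a using hom_in_carrier[OF p_hom, of a] that by simp
  have Q_one: "\<one>\<^bsub>Q\<^esub> = N" by (simp add: Q_def FactGroup_def)
  have p_one: "p a = \<one>\<^bsub>Q\<^esub> \<longleftrightarrow> a \<in> N" if "a \<in> A" for a
    using F.coset_join1[OF _ A_carrier[OF that] N(2)] F.coset_join2[OF A_carrier[OF that] N(2)]
    by (auto simp: Q_one p_def)
  have p_surj: "\<exists>a\<in>A. x = p a" if "x \<in> carrier Q" for x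
    using that by (auto simp: Q_def FactGroup_def RCOSETS_def p_FA)
  have A_inv: "inv\<^bsub>F\<^esub> a \<in> A" if "a \<in> A" for a using subgroup.m_inv_closed[OF A(2) that] .
  have A_mult: "a \<otimes>\<^bsub>F\<^esub> b \<in> A" if "a \<in> A" "b \<in> A" for a b using subgroup.m_closed[OF A(2) that] .
  have p_inv: "p (inv\<^bsub>F\<^esub> a) = inv\<^bsub>Q\<^esub> p a" if a: "a \<in> A" for a
  proof (rule Q.inv_equality[symmetric])
    have "p (inv\<^bsub>F\<^esub> a) \<otimes>\<^bsub>Q\<^esub> p a = p \<one>\<^bsub>F\<^esub>"
      using p_mult[OF A_inv[OF a] a] A_carrier[OF a] by simp
    also have "\<dots> = \<one>\<^bsub>Q\<^esub>" using p_one subgroup.one_closed[OF A(2)] subgroup.one_closed[OF N(2)] by auto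
    finally show "p (inv\<^bsub>F\<^esub> a) \<otimes>\<^bsub>Q\<^esub> p a = \<one>\<^bsub>Q\<^esub>" .
  qed (use a A_inv p_closed in auto)
  have commute: "p a \<otimes>\<^bsub>Q\<^esub> p b = p b \<otimes>\<^bsub>Q\<^esub> p a" if a: "a \<in> A" and b: "b \<in> A" for a b
  proof -
    \<comment> \<open>Because \<open>2 * s \<ge> s + n\<close>, commutators of two elements of
      \<open>A\<close> already lie in \<open>N\<close>.\<close>
    have "a \<in> gamma F (s + n)" "b \<in> gamma F s"
      using a b A2s F.gamma_antimono[of "s + n" "2 * s"] F.gamma_antimono[of s "2 * s"] sn by auto
    then have k: "gcomm F a b \<in> N" unfolding N_eq by (rule F.gcomm_in_comm_sub)
    then have "p (gcomm F a b) = \<one>\<^bsub>Q\<^esub>" using p_one NA by auto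
    then have "p (b \<otimes>\<^bsub>F\<^esub> a \<otimes>\<^bsub>F\<^esub> gcomm F a b) = p b \<otimes>\<^bsub>Q\<^esub> p a"
      using a b k NA by (simp add: p_mult A_mult subsetD p_closed)
    then show ?thesis
      using F.mult_gcomm[OF A_carrier[OF a] A_carrier[OF b]] p_mult[OF a b] by simp
  qed
  have comm_Q: "comm_group Q"
  proof (rule Q.group_comm_groupI)
    fix x y assume "x \<in> carrier Q" "y \<in> carrier Q"
    then show "x \<otimes>\<^bsub>Q\<^esub> y = y \<otimes>\<^bsub>Q\<^esub> x" using p_surj commute by blast
  qed
  interpret Q: comm_group Q by (rule comm_Q)

  have Z_A: "ceval m z \<in> A" if zZ: "z \<in> Z" for z
  proof -
    obtain b a where "z = Comm b a" "b \<in> Y" "a \<in> Y" using zZ by (auto simp: Z_def)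
    moreover have "ceval m y \<in> gamma F s" if "y \<in> Y" for y
      using that F.ev_gamma[of y] F.gamma_antimono[of s "wt y"] by (auto simp: Y_eq)
    ultimately show ?thesis by (simp add: A_eq F.gcomm_in_comm_sub flip: F_def)
  qed
  have Z_basic: "basic m r z" "wt z < d" if zZ: "z \<in> Z" for z
  proof -
    obtain b a where z: "z = Comm b a" "b \<in> Y" "a \<in> Y" "(a, b) \<in> r" using zZ by (auto simp: Z_def)
    then show "basic m r z"
      unfolding z(1) using sn by (intro basic_Comm_low_wt[OF r]) (auto simp: Y_eq)
    show "wt z < d" using z sn by (auto simp: Y_eq d_def)
  qed

  have independent: "x = 0"
    if x: "Poly_Mapping.keys x \<subseteq> Z" and g: "g \<in> N" and gx: "dev d g - frag_extend q x \<in> deg_ge d" for x g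
  proof -
    obtain y where y: "Poly_Mapping.keys y \<subseteq> {Comm u v |u v. basic m r (Comm u v) \<and> s + n \<le> wt u \<and> wt u + wt v < d}"
      "dev d g - frag_extend q y \<in> deg_ge d"
      using dev_comm_sub_gamma_span[OF r sn(1,4,2) d_def g[unfolded N_eq F_def]] unfolding q_def by blast
    \<comment> \<open>Left entries have weight below \<open>s + n\<close> for terms in
      \<open>Z\<close> and at least \<open>s + n\<close> for terms of \<open>y\<close>.\<close>
    have disj: "Poly_Mapping.keys x \<inter> Poly_Mapping.keys y = {}"
      using x y(1) by (fastforce simp: Z_def Y_eq)
    have "Poly_Mapping.keys (x - y) \<subseteq> Poly_Mapping.keys x \<union> Poly_Mapping.keys y" by (rule keys_diff)
    then have keys: "Poly_Mapping.keys (x - y) \<subseteq> {t. basic m r t \<and> wt t < d}"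
      using x y(1) Z_basic by fastforce
    have "frag_extend q (x - y) = (dev d g - frag_extend q y) - (dev d g - frag_extend q x)"
      by (simp add: frag_extend_diff)
    moreover have "\<dots> \<in> deg_ge d" by (rule deg_ge_diff[OF y(2) gx])
    ultimately have "frag_extend q (x - y) \<in> deg_ge d" by simp
    then have "x - y = 0"
      using keys by (intro leading_lie_pol_independent[OF r keys, of q])
        (auto simp: q_def intro!: dev_ceval[OF r])
    then have "x = y" by simp
    then show ?thesis using disj by simp
  qed

  define B where "B = (\<lambda>z. p (ceval m z)) ` Z"
  have inj: "inj_on (\<lambda>z. p (ceval m z)) Z"
  proof (rule inj_onI)
    fix z z' assume z: "z \<in> Z" "z' \<in> Z" and eq: "p (ceval m z) = p (ceval m z')"
    note zA = Z_A[OF z(1)] Z_A[OF z(2)]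
    have "ceval m z \<otimes>\<^bsub>F\<^esub> inv\<^bsub>F\<^esub> ceval m z' \<in> N"
      using F.r_coset_eq_mem[OF N(1) A_carrier[OF zA(1)] A_carrier[OF zA(2)]] eq by (simp add: p_def)
    moreover have "dev d (ceval m z \<otimes>\<^bsub>F\<^esub> inv\<^bsub>F\<^esub> ceval m z') - (q z - q z') \<in> deg_ge d"
      unfolding F_def q_def using zA ds A_dev A_carrier
      by (intro dev_mult_inv[where k = "2 * s"]) (auto simp: F_def)
    moreover have "Poly_Mapping.keys (frag_of z - frag_of z') \<subseteq> Z"
      using keys_diff[of "frag_of z" "frag_of z'"] z by auto
    ultimately have "frag_of z - frag_of z' = 0"
      by (intro independent) (auto simp: frag_extend_diff)
    then show "z = z'" by (simp add: frag_of_eq)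
  qed
  define pre where "pre = inv_into Z (\<lambda>z. p (ceval m z))"
  have pre: "pre b \<in> Z" "p (ceval m (pre b)) = b" if "b \<in> B" for b
    using that inv_into_into[of b "\<lambda>z. p (ceval m z)" Z] f_inv_into_f[of b "\<lambda>z. p (ceval m z)" Z]
    by (simp_all add: pre_def B_def)
  have BQ: "id ` B \<subseteq> carrier Q" using Z_A p_closed by (auto simp: B_def)
  obtain h where h: "h \<in> hom (free_Abelian_group B) Q" and h_of: "\<And>b. b \<in> B \<Longrightarrow> h (frag_of b) = b"
    using Q.free_Abelian_group_universal[OF BQ] by auto
  interpret h: group_hom "free_Abelian_group B" Q h
    using h by (auto simp: group_hom_def group_hom_axioms_def Q.is_group)
  define pull where "pull = frag_extend (\<lambda>b. frag_of (pre b))"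
  \<comment> \<open>The values of \<open>h\<close> are prescribed only on the basis. This predicate
    ties \<open>h x\<close> to an element of \<open>A\<close> whose deviation is the combination
    given by \<open>x\<close>, so that a relation in \<open>Q\<close> becomes one between
    deviations.\<close>
  define represents where
    "represents x \<longleftrightarrow> (\<exists>g\<in>A. h x = p g \<and> dev d g - frag_extend q (pull x) \<in> deg_ge d)" for x
  have represent: "represents x" if "Poly_Mapping.keys x \<subseteq> B" for x
    using that
  proof (rule free_Abelian_group_induct)
    show "represents 0"
      unfolding represents_def
      using h.hom_one p_one[of "\<one>\<^bsub>F\<^esub>"] subgroup.one_closed[OF A(2)] subgroup.one_closed[OF N(2)]
      by (intro bexI[of _ "\<one>\<^bsub>F\<^esub>"]) (auto simp: pull_def F_def dev_one)
  next
    fix x y assume xy: "Poly_Mapping.keys x \<subseteq> B" "Poly_Mapping.keys y \<subseteq> B"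
      and "represents x" "represents y"
    then obtain g k where g: "g \<in> A" "h x = p g" "dev d g - frag_extend q (pull x) \<in> deg_ge d"
      and k: "k \<in> A" "h y = p k" "dev d k - frag_extend q (pull y) \<in> deg_ge d"
      unfolding represents_def by blast
    let ?g = "g \<otimes>\<^bsub>F\<^esub> inv\<^bsub>F\<^esub> k"
    have xyc: "x \<in> carrier (free_Abelian_group B)" "y \<in> carrier (free_Abelian_group B)"
      using xy by simp_all
    have "h (x - y) = h (x \<otimes>\<^bsub>free_Abelian_group B\<^esub> inv\<^bsub>free_Abelian_group B\<^esub> y)"
      using xy by simp
    also have "\<dots> = h x \<otimes>\<^bsub>Q\<^esub> inv\<^bsub>Q\<^esub> h y"
      by (simp only: h.hom_mult[OF xyc(1) h.G.inv_closed[OF xyc(2)]] h.hom_inv[OF xyc(2)])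
    also have "\<dots> = p ?g" using g k A_inv by (simp add: p_mult p_inv)
    finally have "h (x - y) = p ?g" .
    moreover have "dev d ?g - frag_extend q (pull (x - y)) \<in> deg_ge d"
    proof -
      have 1: "dev d ?g - (dev d g - dev d k) \<in> deg_ge d"
        unfolding F_def using g k ds A_dev A_carrier
        by (intro dev_mult_inv[where k = "2 * s"]) (auto simp: F_def)
      have "dev d ?g - frag_extend q (pull (x - y)) =
        (dev d ?g - (dev d g - dev d k)) + (dev d g - frag_extend q (pull x)) - (dev d k - frag_extend q (pull y))"
        by (simp add: pull_def frag_extend_diff)
      also have "\<dots> \<in> deg_ge d" by (rule deg_ge_diff[OF deg_ge_add[OF 1 g(3)] k(3)])
      finally show ?thesis .
    qed
    ultimately show "represents (x - y)" unfolding represents_def using g k A_inv A_mult by blast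
  next
    fix b assume "b \<in> B"
    then show "represents (frag_of b)"
      unfolding represents_def using pre[of b] h_of[of b] Z_A
      by (intro bexI[of _ "ceval m (pre b)"]) (auto simp: pull_def q_def)
  qed
  have ker: "x = 0" if x: "Poly_Mapping.keys x \<subseteq> B" and hx: "h x = \<one>\<^bsub>Q\<^esub>" for x
  proof -
    obtain g where g: "g \<in> A" "h x = p g" "dev d g - frag_extend q (pull x) \<in> deg_ge d"
      using represent[OF x] unfolding represents_def by blast
    have "Poly_Mapping.keys (pull x) \<subseteq> pre ` Poly_Mapping.keys x"
      using keys_frag_extend[of "\<lambda>b. frag_of (pre b)" x] by (auto simp: pull_def)
    then have "Poly_Mapping.keys (pull x) \<subseteq> Z" using x pre(1) by blast
    moreover have "g \<in> N" using p_one[OF g(1)] g(2) hx by simp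
    ultimately have "pull x = 0" using g(3) by (rule independent)
    \<comment> \<open>Pushing \<open>pull x\<close> forward to \<open>B\<close> gives back
      \<open>x\<close>.\<close>
    then have "0 = frag_extend (\<lambda>z. frag_of (p (ceval m z))) (pull x)" by simp
    also have "\<dots> = frag_extend frag_of x"
      unfolding pull_def frag_extend_comp using pre x by (intro frag_extend_eq) auto
    finally show ?thesis by (simp flip: frag_expansion)
  qed
  have surj: "carrier Q \<subseteq> h ` carrier (free_Abelian_group B)"
  proof -
    let ?I = "h ` carrier (free_Abelian_group B)"
    have I: "subgroup ?I Q" by (rule h.img_is_subgroup)
    \<comment> \<open>The preimage in \<open>A\<close> of the image of \<open>h\<close> is a
      subgroup containing the generators from \<open>comm_sub_gamma_generated\<close>, hence all of
      \<open>A\<close>.\<close>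
    have "subgroup {a \<in> A. p a \<in> ?I} F"
    proof (rule F.subgroupI)
      show "{a \<in> A. p a \<in> ?I} \<subseteq> carrier F" using A_carrier by auto
      have "\<one>\<^bsub>F\<^esub> \<in> {a \<in> A. p a \<in> ?I}"
        using p_one[of "\<one>\<^bsub>F\<^esub>"] subgroup.one_closed[OF A(2)] subgroup.one_closed[OF N(2)]
          subgroup.one_closed[OF I] by simp
      then show "{a \<in> A. p a \<in> ?I} \<noteq> {}" by blast
    qed (use A_inv A_mult p_inv p_mult subgroup.m_closed[OF I] subgroup.m_inv_closed[OF I] in auto)
    moreover have "N \<union> {ceval m (Comm b a) |b a. b \<in> Y \<and> a \<in> Y \<and> (a, b) \<in> r} \<subseteq> {a \<in> A. p a \<in> ?I}"
    proof
      fix a assume "a \<in> N \<union> {ceval m (Comm b a) |b a. b \<in> Y \<and> a \<in> Y \<and> (a, b) \<in> r}"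
      then show "a \<in> {a \<in> A. p a \<in> ?I}"
      proof
        assume "a \<in> N"
        then show ?thesis using NA p_one[of a] subgroup.one_closed[OF I] by auto
      next
        assume "a \<in> {ceval m (Comm b a) |b a. b \<in> Y \<and> a \<in> Y \<and> (a, b) \<in> r}"
        then obtain z where z: "z \<in> Z" "a = ceval m z" unfolding Z_def by blast
        then have "p a \<in> B" by (auto simp: B_def)
        then have "p a \<in> ?I" using h_of[of "p a"] by (intro image_eqI[of _ _ "frag_of (p a)"]) auto
        then show ?thesis using z Z_A by simp
      qed
    qed
    ultimately have "A \<subseteq> {a \<in> A. p a \<in> ?I}"
      using F.generate_subgroup_incl F.comm_sub_gamma_generated[OF sn(1,3)]
      unfolding A_eq[symmetric] N_eq[symmetric] Y_eq[symmetric] by blast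
    then show ?thesis using p_surj by blast
  qed
  have "h \<in> iso (free_Abelian_group B) Q"
    using surj ker by (auto simp: h.iso_iff)
  then have "free_abelian_basis Q B"
    unfolding free_abelian_basis_def using comm_Q BQ h_of by auto
  then show ?thesis using multiplier inj unfolding B_def p_def by simp
qed

end
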